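(* In the Clifford algebra $\mathrm{Cl}(8)$ of 8-dimensional Euclidean space with orthonormal basis $e_1,\dots,e_8$, take the simple roots of $E_8$ $$\alpha_1=\tfrac{1}{\sqrt2}(e_7-e_6),\ \alpha_2=\tfrac{1}{\sqrt2}(e_6-e_5),\ \alpha_3=\tfrac{1}{\sqrt2}(e_5-e_4),\ \alpha_4=\tfrac{1}{\sqrt2}(e_4-e_3),$$ $$\alpha_5=\tfrac{1}{\sqrt2}(e_3-e_2),\ \alpha_6=\tfrac{1}{\sqrt2}(e_2-e_1),\ \alpha_8=\tfrac{1}{\sqrt2}(e_2+e_1),$$ $$\alpha_7=\tfrac{1}{\sqrt8}(e_1-e_2-e_3-e_4-e_5-e_6-e_7+e_8).$$ Then the Coxeter versor $W=\alpha_2\alpha_4\alpha_6\alpha_8\alpha_3\alpha_5\alpha_1\alpha_7$ is given by $$W=\tfrac1{16}\big(-1+e_{234567}+e_{12345678}-e_{145678}-e_{123678}-e_{4567}-e_{2367}$$ $$+e_{1678}+e_{125678}+e_{67}+e_{2567}+e_{135678}-e_{124678}+e_{3567}-e_{2467}$$ $$-e_{134678}-e_{3467}+e_{1348}+e_{34}+e_{123478}-e_{1478}+e_{2347}+e_{123578}$$ $$-e_{47}+e_{2357}-e_{1578}-e_{57}-2e_{1567}+e_{1568}+e_{1278}+e_{56}+e_{1378}$$ $$+e_{37}+e_{2457}+e_{134578}+2e_{1347}-e_{134568}+e_{3457}+6e_{134567}-e_{3456}$$ $$+4e_{124567}-e_{124568}-e_{1268}-e_{2456}+2e_{1267}-e_{123568}+e_{27}+2e_{17}-e_{18}$$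 $$-e_{26}+4e_{123567}-e_{2356}+2e_{123467}-e_{123468}-e_{2346}+e_{1248}+e_{24}$$ $$-e_{1258}+2e_{1257}-e_{25}+e_{1238}+e_{23}-e_{123458}+2e_{123457}+e_{1468}-e_{2345}$$ $$+e_{124578}-4e_{1467}-e_{1368}+e_{1458}+4e_{1357}-e_{1358}-2e_{1456}-2e_{1356}-4e_{1346}$$ $$+2e_{14}+2e_{13}-4e_{1345}-2e_{1246}-2e_{1236}-2e_{1245}-2e_{1235}+e_{46}+e_{45}-e_{36}-e_{35}\big)$$ and it factorises as $$W=-\exp\!\left(\tfrac{\pi}{30}B_C\right)\exp\!\left(\tfrac{11\pi}{30}B_2\right)\exp\!\left(\tfrac{7\pi}{30}B_3\right)\exp\!\left(\tfrac{13\pi}{30}B_4\right),$$ where the eigenplane bivectors $B_C,B_2,B_3,B_4$ are orthogonal to one another, $B_C$ is the bivector of the Coxeter plane, and they are explicitly given, after normalisation to unit bivectors, by the outer products of the following vector pairs (numerically): $B_C=v_1\wedge w_1$, $B_2=v_2\wedge w_2$, $B_3=v_3\wedge w_3$, $B_4=v_4\wedge w_4$, with $$v_1=2.8129e_3+2.8129e_4+4.5514e_5+4.5514e_6+5.1395e_7+21.771e_8,$$ $$w_1=-0.23919e_1+1.6534e_2+1.6534e_3+3.9417e_4+3.9417e_5+5.1113e_6+5.1113e_7+21.652e_8,$$ $$v_2=1.1504e_3+1.1504e_4+1.8614e_5+1.8614e_6-0.2405e_7-1.0188e_8,$$ $$w_2=2.0904e_1-0.6762e_2-0.6762e_3+1.612e_4+1.612e_5-0.097822e_6-0.097822e_7-0.4144e_8,$$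 $$v_3=2.1019e_3+2.1019e_4-1.2991e_5-1.2991e_6-4.112e_7+0.97071e_8,$$ $$w_3=-0.58484e_1+1.9991e_2+1.9991e_3+1.125e_4+1.125e_5-3.0558e_6-3.0558e_7+0.72138e_8,$$ $$v_4=0.58806e_3+0.58806e_4-0.36344e_5-0.36344e_6+0.78698e_7-0.18578e_8,$$ $$w_4=0.85493e_1+0.55928e_2+0.55928e_3-0.31475e_4-0.31475e_5+0.16362e_6+0.16362e_7-0.038626e_8.$$ Consequently the Coxeter element $w:v\mapsto\tilde WvW$ acts as a $30$-fold rotation in each of these four orthogonal planes, giving the exponents $\{1,7,11,13,17,19,23,29\}$, i.e. its complex eigenvalues are $\exp(2\pi i m/30)$ with $m$ running through this set.
   Context: $\mathrm{Cl}(8)$ is the real Clifford algebra generated by $e_1,\dots,e_8$ with $e_i^2=1$ and $e_ie_j=-e_je_i$ for $i\neq j$; $e_{ij\dots k}$ denotes the product $e_ie_j\cdots e_k$. The tilde denotes reversal of the order of vector factors. For a unit root $\alpha$ the reflection is $s_\alpha v=-\alpha v\alpha$. The Coxeter element $w$ is the product of the simple reflections and is given by $wv=\tilde WvW$, where the Coxeter versor $W$ is the corresponding product of the simple roots. The Coxeter number of $E_8$ is $h=30$. The outer product of vectors is $v\wedge w=\tfrac12(vw-wv)$; the normalisation of $v\wedge w$ to a unit bivector means division by $\sqrt{|v|^2|w|^2-(v\cdot w)^2}$, so that the resulting $B$ satisfies $B^2=-1$. Bivectors are called orthogonal here when their planes are orthogonal; such bivectors commute. $\exp(\theta B)=\cos\theta+B\sin\theta$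 for a unit bivector $B$. The numerical coefficients of the vectors are rounded decimal values, so the identities involving them hold up to rounding. The Coxeter plane is the unique plane on which $w$ acts as a rotation by $2\pi/h$. The exponents are the integers $m$, $0<m<h$, such that $\exp(2\pi i m/h)$ are the complex eigenvalues of $w$. *)

theory Defs
  imports Complex_Main "Jordan_Normal_Form.Char_Poly"
begin

section \<open>The real Clifford algebra of 8-dimensional Euclidean space\<close>

text \<open>
  A multivector is the family of its coefficients with respect to the 256 basis blades
  \<open>e_A\<close>, \<open>A \<subseteq> {1..8}\<close>, where \<open>e_A\<close> is the product of the \<open>e_i\<close>, \<open>i \<in> A\<close>, in increasing
  order of indices.
\<close>

typedef cl8 = "{f :: nat set \<Rightarrow> real. \<forall>A. \<not> A \<subseteq> {1..8} \<longrightarrow> f A = 0}"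
  morphisms coef Abs_cl8
  by (rule exI[of _ "\<lambda>_. 0"]) simp

abbreviation blades :: "nat set set" where
  "blades \<equiv> Pow {1..8}"

definition mk :: "(nat set \<Rightarrow> real) \<Rightarrow> cl8" where
  "mk f = Abs_cl8 (\<lambda>A. if A \<subseteq> {1..8} then f A else 0)"

lemma coef_mk [simp]: "coef (mk f) A = (if A \<subseteq> {1..8} then f A else 0)"
  unfolding mk_def by (subst Abs_cl8_inverse) auto

lemma coef_outside: "\<not> A \<subseteq> {1..8} \<Longrightarrow> coef x A = 0"
  using coef[of x] by auto

lemma cl8_eqI: "(\<And>A. A \<subseteq> {1..8} \<Longrightarrow> coef x A = coef y A) \<Longrightarrow> x = y"
  by (metis coef_inject coef_outside ext)

text \<open>
  Sorting \<open>e_A e_B\<close> exchanges two anticommuting generators for each pair \<open>b < a\<close> with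
  \<open>a \<in> A\<close>, \<open>b \<in> B\<close>; the generators occurring twice then cancel because \<open>e_i\<^sup>2 = 1\<close>.
\<close>

definition blade_sign :: "nat set \<Rightarrow> nat set \<Rightarrow> real" where
  "blade_sign A B = (\<Prod>a\<in>A. \<Prod>b\<in>B. if b < a then - 1 else 1)"

lemma abs_blade_sign: "\<bar>blade_sign A B\<bar> = 1"
  unfolding blade_sign_def abs_prod by (intro prod.neutral ballI) auto

lemma prod_sym_diff:
  fixes f :: "nat \<Rightarrow> real"
  assumes "finite A" "finite B" "\<And>x. f x * f x = 1"
  shows "prod f (sym_diff A B) = prod f A * prod f B"
proof -
  have 1: "prod f (sym_diff A B) = prod f (A - B) * prod f (B - A)"
    using assms by (intro prod.union_disjoint) auto
  have 2: "prod f A = prod f (A - B) * prod f (A \<inter> B)"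
    using assms by (subst prod.union_disjoint[symmetric]) (auto intro!: prod.cong)
  have 3: "prod f B = prod f (B - A) * prod f (A \<inter> B)"
    using assms by (subst prod.union_disjoint[symmetric]) (auto intro!: prod.cong)
  have 4: "prod f (A \<inter> B) * prod f (A \<inter> B) = 1"
    using assms by (simp add: prod.distrib[symmetric])
  show ?thesis unfolding 1 2 3 using 4 by (simp add: algebra_simps)
qed

lemma blade_sign_left:
  assumes "finite A" "finite B"
  shows "blade_sign (sym_diff A B) C = blade_sign A C * blade_sign B C"
  unfolding blade_sign_def using assms
  by (intro prod_sym_diff) (auto simp: prod.distrib[symmetric] intro!: prod.neutral)

lemma blade_sign_right:
  assumes "finite B" "finite C"
  shows "blade_sign A (sym_diff B C) = blade_sign A B * blade_sign A C"
proof -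
  have "(\<Prod>b\<in>sym_diff B C. if b < a then - 1 else 1 :: real) =
        (\<Prod>b\<in>B. if b < a then - 1 else 1) * (\<Prod>b\<in>C. if b < a then - 1 else 1)" for a
    using assms by (intro prod_sym_diff) auto
  then show ?thesis unfolding blade_sign_def by (simp add: prod.distrib)
qed

lemma blade_sign_empty [simp]: "blade_sign {} A = 1" "blade_sign A {} = 1"
  by (simp_all add: blade_sign_def)

instantiation cl8 :: real_algebra_1
begin

definition "0 = mk (\<lambda>_. 0)"
definition "1 = mk (\<lambda>A. if A = {} then 1 else 0)"
definition "x + y = mk (\<lambda>A. coef x A + coef y A)"
definition "x - y = mk (\<lambda>A. coef x A - coef y A)"
definition "- x = mk (\<lambda>A. - coef x A)"
definition "r *\<^sub>R x = mk (\<lambda>A. r * coef x A)"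
definition "x * y = mk (\<lambda>C. \<Sum>A\<in>blades. \<Sum>B\<in>blades.
  if sym_diff A B = C then blade_sign A B * coef x A * coef y B else 0)"

lemma coef_arith [simp]:
  "coef 0 A = 0"
  "coef 1 A = (if A = {} then 1 else 0)"
  "coef (x + y) A = coef x A + coef y A"
  "coef (x - y) A = coef x A - coef y A"
  "coef (- x) A = - coef x A"
  "coef (r *\<^sub>R x) A = r * coef x A"
  by (auto simp: zero_cl8_def one_cl8_def plus_cl8_def minus_cl8_def uminus_cl8_def
      scaleR_cl8_def coef_outside)

lemma coef_times: "coef (x * y) C = (\<Sum>A\<in>blades. \<Sum>B\<in>blades.
  if sym_diff A B = C then blade_sign A B * coef x A * coef y B else 0)"
proof (cases "C \<subseteq> {1..8}")
  case False
  then have "sym_diff A B \<noteq> C" if "A \<in> blades" "B \<in> blades" for A B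
    using that by blast
  with False show ?thesis by (simp add: times_cl8_def)
qed (simp add: times_cl8_def)

lemma sum_blades_delta:
  fixes g :: "nat set \<Rightarrow> real"
  assumes "P \<in> blades"
  shows "(\<Sum>Q\<in>blades. if P = Q then g Q else 0) = g P"
  using assms by (subst sum.delta') auto

lemma sum_coef_times:
  "(\<Sum>C\<in>blades. coef (x * y) C * g C) =
   (\<Sum>A\<in>blades. \<Sum>B\<in>blades. blade_sign A B * coef x A * coef y B * g (sym_diff A B))"
proof -
  let ?t = "\<lambda>A B. blade_sign A B * coef x A * coef y B"
  have "(\<Sum>C\<in>blades. coef (x * y) C * g C) =
        (\<Sum>C\<in>blades. \<Sum>A\<in>blades. \<Sum>B\<in>blades. if sym_diff A B = C then ?t A B * g C else 0)"
    unfolding coef_times sum_distrib_right by (intro sum.cong refl) simp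
  also have "\<dots> = (\<Sum>A\<in>blades. \<Sum>C\<in>blades. \<Sum>B\<in>blades. if sym_diff A B = C then ?t A B * g C else 0)"
    by (rule sum.swap)
  also have "\<dots> = (\<Sum>A\<in>blades. \<Sum>B\<in>blades. \<Sum>C\<in>blades. if sym_diff A B = C then ?t A B * g C else 0)"
    by (intro sum.cong refl sum.swap)
  also have "\<dots> = (\<Sum>A\<in>blades. \<Sum>B\<in>blades. ?t A B * g (sym_diff A B))"
    by (intro sum.cong refl sum_blades_delta) auto
  finally show ?thesis .
qed

instance
proof
  fix x y z :: cl8 and r s :: real
  show "x + y + z = x + (y + z)" "x + y = y + x" "0 + x = x" "- x + x = 0" "x - y = x + - y"
    "r *\<^sub>R (x + y) = r *\<^sub>R x + r *\<^sub>R y" "(r + s) *\<^sub>R x = r *\<^sub>R x + s *\<^sub>R x"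
    "r *\<^sub>R s *\<^sub>R x = (r * s) *\<^sub>R x" "1 *\<^sub>R x = x"
    by (auto intro!: cl8_eqI simp: algebra_simps)
  show "(0::cl8) \<noteq> 1"
  proof
    assume "(0::cl8) = 1"
    then have "coef 0 {} = coef 1 {}" by simp
    then show False by simp
  qed
  show "(x + y) * z = x * z + y * z" "x * (y + z) = x * y + x * z"
    by (intro cl8_eqI; simp only: coef_times coef_arith sum.distrib[symmetric];
        intro sum.cong refl; simp add: algebra_simps)+
  show "r *\<^sub>R x * y = r *\<^sub>R (x * y)" "x * r *\<^sub>R y = r *\<^sub>R (x * y)"
    by (intro cl8_eqI; simp only: coef_times coef_arith sum_distrib_left;
        intro sum.cong refl; simp)+
  show "1 * x = x"
  proof (rule cl8_eqI)
    fix C :: "nat set" assume C: "C \<subseteq> {1..8}"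
    have "coef (1 * x) C = (\<Sum>A\<in>blades. if {} = A then \<Sum>B\<in>blades. if C = B then coef x B else 0 else 0)"
      unfolding coef_times
    proof (intro sum.cong refl, goal_cases)
      case (1 A)
      show ?case by (cases "A = {}") (auto intro!: sum.cong cong: if_cong)
    qed
    also have "\<dots> = (\<Sum>B\<in>blades. if C = B then coef x B else 0)"
      by (rule sum_blades_delta) simp
    also have "\<dots> = coef x C"
      using C by (intro sum_blades_delta) simp
    finally show "coef (1 * x) C = coef x C" .
  qed
  show "x * 1 = x"
  proof (rule cl8_eqI)
    fix C :: "nat set" assume C: "C \<subseteq> {1..8}"
    have "coef (x * 1) C = (\<Sum>A\<in>blades. if C = A then \<Sum>B\<in>blades. if {} = B then coef x A else 0 else 0)"
      unfolding coef_times
    proof (intro sum.cong refl, goal_cases)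
      case (1 A)
      have "(if sym_diff A B = C then blade_sign A B * coef x A * coef 1 B else 0) =
            (if C = A then if {} = B then coef x A else 0 else 0)" for B
        by (cases "B = {}") auto
      then show ?case by simp
    qed
    also have "\<dots> = (\<Sum>B\<in>blades. if {} = B then coef x C else 0)"
      using C by (intro sum_blades_delta) simp
    also have "\<dots> = coef x C"
      by (rule sum_blades_delta) simp
    finally show "coef (x * 1) C = coef x C" .
  qed
  show "x * y * z = x * (y * z)"
  proof (rule cl8_eqI)
    fix D :: "nat set" assume "D \<subseteq> {1..8}"
    have fin: "finite A" if "A \<in> blades" for A :: "nat set"
      using that finite_subset by auto
    have "coef (x * y * z) D = (\<Sum>P\<in>blades. coef (x * y) P *
        (\<Sum>C\<in>blades. if sym_diff P C = D then blade_sign P C * coef z C else 0))"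
      unfolding coef_times[of "x * y"] sum_distrib_left by (intro sum.cong refl) simp
    also have "\<dots> = (\<Sum>A\<in>blades. \<Sum>B\<in>blades. blade_sign A B * coef x A * coef y B *
        (\<Sum>C\<in>blades. if sym_diff (sym_diff A B) C = D then blade_sign (sym_diff A B) C * coef z C else 0))"
      by (rule sum_coef_times)
    also have "\<dots> = (\<Sum>A\<in>blades. \<Sum>B\<in>blades. \<Sum>C\<in>blades. blade_sign B C * coef y B * coef z C *
        (if sym_diff A (sym_diff B C) = D then blade_sign A (sym_diff B C) * coef x A else 0))"
    proof (unfold sum_distrib_left, intro sum.cong refl)
      fix A B C :: "nat set"
      assume ABC: "A \<in> blades" "B \<in> blades" "C \<in> blades"
      have assoc: "sym_diff (sym_diff A B) C = sym_diff A (sym_diff B C)" by blast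
      show "blade_sign A B * coef x A * coef y B *
          (if sym_diff (sym_diff A B) C = D then blade_sign (sym_diff A B) C * coef z C else 0) =
        blade_sign B C * coef y B * coef z C *
          (if sym_diff A (sym_diff B C) = D then blade_sign A (sym_diff B C) * coef x A else 0)"
        unfolding assoc blade_sign_left[OF ABC(1,2)[THEN fin]] blade_sign_right[OF ABC(2,3)[THEN fin]]
        by simp
    qed
    also have "\<dots> = (\<Sum>A\<in>blades. \<Sum>Q\<in>blades. coef (y * z) Q *
        (if sym_diff A Q = D then blade_sign A Q * coef x A else 0))"
      by (intro sum.cong refl sum_coef_times[symmetric])
    also have "\<dots> = coef (x * (y * z)) D"
      unfolding coef_times[of x "y * z"] by (intro sum.cong refl) simp
    finally show "coef (x * y * z) D = coef (x * (y * z)) D" .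
  qed
qed

end

text \<open>
  The sum norm on coefficients makes \<^typ>\<open>cl8\<close> a Banach algebra, so that \<^const>\<open>exp\<close> is the
  exponential series. It is not the Euclidean norm on vectors, whose square is \<open>vdot v v\<close> below.
\<close>

instantiation cl8 :: real_normed_algebra_1
begin

definition "norm x = (\<Sum>A\<in>blades. \<bar>coef x A\<bar>)"
definition "dist x y = norm (x - y)" for x y :: cl8
definition "sgn x = x /\<^sub>R norm x" for x :: cl8
definition [code del]:
  "(uniformity :: (cl8 \<times> cl8) filter) = (INF e\<in>{0 <..}. principal {(x, y). dist x y < e})"
definition [code del]:
  "open (U :: cl8 set) \<longleftrightarrow> (\<forall>x\<in>U. eventually (\<lambda>(x', y). x' = x \<longrightarrow> y \<in> U) uniformity)"

instance
proof
  fix x y :: cl8 and r :: real and U :: "cl8 set"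
  show "dist x y = norm (x - y)" "sgn x = x /\<^sub>R norm x"
    "(uniformity :: (cl8 \<times> cl8) filter) = (INF e\<in>{0 <..}. principal {(x, y). dist x y < e})"
    "open U \<longleftrightarrow> (\<forall>x\<in>U. eventually (\<lambda>(x', y). x' = x \<longrightarrow> y \<in> U) uniformity)"
    by (rule dist_cl8_def sgn_cl8_def uniformity_cl8_def open_cl8_def)+
  show "norm x = 0 \<longleftrightarrow> x = 0"
    unfolding norm_cl8_def by (subst sum_nonneg_eq_0_iff) (auto intro: cl8_eqI)
  show "norm (x + y) \<le> norm x + norm y"
    unfolding norm_cl8_def sum.distrib[symmetric] by (intro sum_mono) simp
  show "norm (r *\<^sub>R x) = \<bar>r\<bar> * norm x"
    by (simp add: norm_cl8_def sum_distrib_left abs_mult)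
  show "norm (x * y) \<le> norm x * norm y"
  proof -
    have "norm (x * y) = (\<Sum>C\<in>blades. coef (x * y) C * sgn (coef (x * y) C))"
      unfolding norm_cl8_def by (intro sum.cong refl) (simp add: mult_sgn_abs abs_sgn)
    also have "\<dots> = (\<Sum>A\<in>blades. \<Sum>B\<in>blades.
        blade_sign A B * coef x A * coef y B * sgn (coef (x * y) (sym_diff A B)))"
      by (rule sum_coef_times)
    also have "\<dots> \<le> (\<Sum>A\<in>blades. \<Sum>B\<in>blades. \<bar>coef x A\<bar> * \<bar>coef y B\<bar>)"
    proof (intro sum_mono)
      fix A B :: "nat set"
      let ?s = "sgn (coef (x * y) (sym_diff A B))"
      have "blade_sign A B * coef x A * coef y B * ?s \<le> \<bar>blade_sign A B * coef x A * coef y B * ?s\<bar>"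
        by simp
      also have "\<dots> = \<bar>coef x A\<bar> * \<bar>coef y B\<bar> * \<bar>?s\<bar>"
        by (simp add: abs_mult abs_blade_sign)
      also have "\<dots> \<le> \<bar>coef x A\<bar> * \<bar>coef y B\<bar>"
        by (rule mult_left_le) (auto simp: abs_sgn_eq)
      finally show "blade_sign A B * coef x A * coef y B * ?s \<le> \<bar>coef x A\<bar> * \<bar>coef y B\<bar>" .
    qed
    also have "\<dots> = norm x * norm y"
      by (simp add: norm_cl8_def sum_product)
    finally show ?thesis .
  qed
  have "norm (1 :: cl8) = (\<Sum>A\<in>blades. if {} = A then 1 else 0)"
    unfolding norm_cl8_def by (intro sum.cong refl) auto
  also have "\<dots> = 1"
    by (rule sum_blades_delta) simp
  finally show "norm (1 :: cl8) = 1" .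
qed

end

lemma abs_coef_le_norm: "\<bar>coef x A\<bar> \<le> norm x"
proof (cases "A \<in> blades")
  case True
  then show ?thesis unfolding norm_cl8_def by (intro member_le_sum) auto
qed (simp add: coef_outside)

instance cl8 :: banach
proof
  fix X :: "nat \<Rightarrow> cl8"
  assume X: "Cauchy X"
  have "convergent (\<lambda>n. coef (X n) A)" for A
  proof (rule Cauchy_convergent, rule metric_CauchyI)
    fix \<epsilon> :: real assume "0 < \<epsilon>"
    then obtain M where M: "\<forall>m\<ge>M. \<forall>n\<ge>M. dist (X m) (X n) < \<epsilon>"
      using X metric_CauchyD by blast
    have "dist (coef (X m) A) (coef (X n) A) \<le> dist (X m) (X n)" for m n
      using abs_coef_le_norm[of "X m - X n" A] by (simp add: dist_norm)
    with M show "\<exists>M. \<forall>m\<ge>M. \<forall>n\<ge>M. dist (coef (X m) A) (coef (X n) A) < \<epsilon>"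
      by (meson order_le_less_trans)
  qed
  then have lim: "(\<lambda>n. coef (X n) A) \<longlonglongrightarrow> lim (\<lambda>n. coef (X n) A)" for A
    by (simp add: convergent_LIMSEQ_iff)
  define L where "L = mk (\<lambda>A. lim (\<lambda>n. coef (X n) A))"
  have "(\<lambda>n. \<Sum>A\<in>blades. \<bar>coef (X n) A - lim (\<lambda>n. coef (X n) A)\<bar>) \<longlonglongrightarrow> (\<Sum>A\<in>blades. 0)"
    by (intro tendsto_sum tendsto_rabs_zero LIM_zero lim)
  moreover have "norm (X n - L) = (\<Sum>A\<in>blades. \<bar>coef (X n) A - lim (\<lambda>n. coef (X n) A)\<bar>)" for n
    unfolding norm_cl8_def L_def by (intro sum.cong refl) auto
  ultimately have "(\<lambda>n. norm (X n - L)) \<longlonglongrightarrow> 0" by simp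
  then have "X \<longlonglongrightarrow> L"
    by (simp add: tendsto_norm_zero_iff LIM_zero_iff)
  then show "convergent X" by (rule convergentI)
qed

text \<open>The generators; the result is \<open>0\<close> for an index outside \<open>{1..8}\<close>.\<close>

definition evec :: "nat \<Rightarrow> cl8" where
  "evec i = mk (\<lambda>A. if A = {i} then 1 else 0)"

lemma coef_evec: "i \<in> {1..8} \<Longrightarrow> coef (evec i) A = (if A = {i} then 1 else 0)"
  by (auto simp: evec_def)

definition eprod :: "nat list \<Rightarrow> cl8" where
  "eprod is = prod_list (map evec is)"

lemma coef_evec_times:
  assumes "i \<in> {1..8}"
  shows "coef (evec i * x) C = blade_sign {i} (sym_diff {i} C) * coef x (sym_diff {i} C)"
proof (cases "C \<subseteq> {1..8}")
  case True
  have "coef (evec i * x) C = (\<Sum>A\<in>blades. if {i} = A then \<Sum>B\<in>blades.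
      if sym_diff {i} C = B then blade_sign {i} B * coef x B else 0 else 0)"
    unfolding coef_times
  proof (intro sum.cong refl, goal_cases)
    case (1 A)
    have flip: "(sym_diff {i} B = C) = (sym_diff {i} C = B)" for B
      by blast
    show ?case
    proof (cases "A = {i}")
      case True
      then show ?thesis
        unfolding coef_evec[OF assms] by (auto simp: flip intro!: sum.cong)
    next
      case False
      then show ?thesis
        unfolding coef_evec[OF assms] by (auto cong: if_cong)
    qed
  qed
  also have "\<dots> = (\<Sum>B\<in>blades. if sym_diff {i} C = B then blade_sign {i} B * coef x B else 0)"
    using assms by (intro sum_blades_delta) auto
  also have "\<dots> = blade_sign {i} (sym_diff {i} C) * coef x (sym_diff {i} C)"
    using assms True by (intro sum_blades_delta) auto
  finally show ?thesis .
next
  case False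
  moreover have "\<not> sym_diff {i} C \<subseteq> {1..8}"
    using False assms by blast
  ultimately show ?thesis by (simp add: coef_outside)
qed

lemma evec_square:
  assumes "i \<in> {1..8}"
  shows "evec i * evec i = 1"
proof (rule cl8_eqI)
  fix C :: "nat set"
  have "sym_diff {i} C = {i} \<longleftrightarrow> C = {}" by blast
  then show "coef (evec i * evec i) C = coef 1 C"
    unfolding coef_evec_times[OF assms] coef_evec[OF assms] by (simp add: blade_sign_def)
qed

lemma evec_anticommute:
  assumes "i \<in> {1..8}" "j \<in> {1..8}" "i \<noteq> j"
  shows "evec i * evec j = - (evec j * evec i)"
proof (rule cl8_eqI)
  fix C :: "nat set"
  have flip: "sym_diff A C = B \<longleftrightarrow> C = sym_diff A B" for A B
    by blast
  have "sym_diff {i} C = {j} \<longleftrightarrow> C = {i, j}" "sym_diff {j} C = {i} \<longleftrightarrow> C = {i, j}"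
    unfolding flip using assms(3) by (simp_all add: insert_Diff_if insert_commute)
  then show "coef (evec i * evec j) C = coef (- (evec j * evec i)) C"
    unfolding coef_arith coef_evec_times[OF assms(1)] coef_evec_times[OF assms(2)]
      coef_evec[OF assms(1)] coef_evec[OF assms(2)]
    using assms(3) by (simp add: blade_sign_def insert_Diff_if)
qed

lemma coef_eprod:
  assumes "sorted_wrt (<) is" "set is \<subseteq> {1..8}"
  shows "coef (eprod is) A = (if A = set is then 1 else 0)"
  using assms
proof (induction "is" arbitrary: A)
  case Nil
  then show ?case by (simp add: eprod_def)
next
  case (Cons i "is")
  have i: "i \<in> {1..8}" and gt: "\<forall>j\<in>set is. i < j"
    using Cons.prems by auto
  have "coef (eprod (i # is)) A = blade_sign {i} (sym_diff {i} A) * coef (eprod is) (sym_diff {i} A)"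
    using coef_evec_times[OF i] by (simp add: eprod_def)
  moreover have "coef (eprod is) (sym_diff {i} A) = (if sym_diff {i} A = set is then 1 else 0)"
    using Cons by simp
  moreover have "sym_diff {i} A = set is \<longleftrightarrow> A = sym_diff {i} (set is)"
    by blast
  moreover have "sym_diff {i} (set is) = set (i # is)"
    using gt by auto
  moreover have "set is - {i} = set is"
    using gt by auto
  moreover have "blade_sign {i} (set is) = 1"
    using gt by (auto simp: blade_sign_def intro!: prod.neutral)
  ultimately show ?case by simp
qed

lemma cl8_expansion: "x = (\<Sum>A\<in>blades. coef x A *\<^sub>R eprod (sorted_list_of_set A))"
proof (rule cl8_eqI)
  fix C :: "nat set" assume C: "C \<subseteq> {1..8}"
  have coef_sum: "coef (sum f S) C = (\<Sum>A\<in>S. coef (f A) C)" if "finite S" for f :: "nat set \<Rightarrow> cl8" and S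
    using that by (induction S rule: finite_induct) auto
  have "coef (\<Sum>A\<in>blades. coef x A *\<^sub>R eprod (sorted_list_of_set A)) C =
        (\<Sum>A\<in>blades. if C = A then coef x A else 0)"
  proof (subst coef_sum, simp, intro sum.cong refl)
    fix A :: "nat set" assume A: "A \<in> blades"
    then have "finite A" using finite_subset by auto
    with A show "coef (coef x A *\<^sub>R eprod (sorted_list_of_set A)) C = (if C = A then coef x A else 0)"
      by (simp add: coef_eprod)
  qed
  also have "\<dots> = coef x C"
    using C by (intro sum_blades_delta) simp
  finally show "coef x C = coef (\<Sum>A\<in>blades. coef x A *\<^sub>R eprod (sorted_list_of_set A)) C" ..
qed

lemma exp_unit_bivector:
  assumes "B * B = - (1 :: cl8)"
  shows "exp (\<theta> *\<^sub>R B) = cos \<theta> *\<^sub>R 1 + sin \<theta> *\<^sub>R B"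
proof -
  have even: "B ^ (2 * k) = (- 1 :: real) ^ k *\<^sub>R 1" for k
    using assms by (induction k) (simp_all add: power2_eq_square mult.assoc[symmetric])
  have "(\<theta> *\<^sub>R B) ^ n /\<^sub>R fact n = (cos_coeff n * \<theta> ^ n) *\<^sub>R 1 + (sin_coeff n * \<theta> ^ n) *\<^sub>R B" for n
  proof (cases "even n")
    case True
    then obtain k where k: "n = 2 * k" by blast
    have "(\<theta> *\<^sub>R B) ^ n /\<^sub>R fact n = (\<theta> ^ n / fact n) *\<^sub>R B ^ (2 * k)"
      unfolding k by (simp add: scaleR_power divide_inverse mult.commute)
    also have "\<dots> = (cos_coeff n * \<theta> ^ n) *\<^sub>R 1"
      unfolding even by (simp add: k cos_coeff_def)
    finally show ?thesis by (simp add: k sin_coeff_def)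
  next
    case False
    then obtain k where k: "n = Suc (2 * k)" by (auto elim: oddE)
    have "(\<theta> *\<^sub>R B) ^ n /\<^sub>R fact n = (\<theta> ^ n / fact n) *\<^sub>R (B * B ^ (2 * k))"
      unfolding k by (simp add: scaleR_power divide_inverse mult.commute)
    also have "\<dots> = (sin_coeff n * \<theta> ^ n) *\<^sub>R B"
      unfolding even by (simp add: k sin_coeff_def)
    finally show ?thesis by (simp add: k cos_coeff_def)
  qed
  moreover have "(\<lambda>n. (cos_coeff n * \<theta> ^ n) *\<^sub>R 1 + (sin_coeff n * \<theta> ^ n) *\<^sub>R B) sums
      (cos \<theta> *\<^sub>R 1 + sin \<theta> *\<^sub>R B)"
    using cos_converges[of \<theta>] sin_converges[of \<theta>]
    by (intro sums_add bounded_linear.sums[OF bounded_linear_scaleR_left]) simp_all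
  ultimately show ?thesis
    using sums_unique2[OF exp_converges[of "\<theta> *\<^sub>R B"]] by simp
qed

definition reversal :: "cl8 \<Rightarrow> cl8" where
  "reversal x = (\<Sum>A\<in>blades. coef x A *\<^sub>R eprod (rev (sorted_list_of_set A)))"

definition vectors :: "cl8 set" where
  "vectors = span (evec ` {1..8})"

text \<open>\<open>v \<cdot> w = (vw + wv) / 2\<close> is a scalar for vectors; \<open>vdot\<close> extracts that scalar.\<close>

definition vdot :: "cl8 \<Rightarrow> cl8 \<Rightarrow> real" where
  "vdot v w = coef ((1/2) *\<^sub>R (v * w + w * v)) {}"

definition outer :: "cl8 \<Rightarrow> cl8 \<Rightarrow> cl8" where
  "outer v w = (1/2) *\<^sub>R (v * w - w * v)"

definition unit_bivector :: "cl8 \<Rightarrow> cl8 \<Rightarrow> cl8" where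
  "unit_bivector v w = outer v w /\<^sub>R sqrt (vdot v v * vdot w w - (vdot v w)\<^sup>2)"

text \<open>
  The orthonormal basis \<open>(a, b)\<close> may have either orientation, so \<open>\<theta>\<close> and \<open>- \<theta>\<close> describe the
  same rotations.
\<close>

definition rotates_plane :: "(cl8 \<Rightarrow> cl8) \<Rightarrow> cl8 set \<Rightarrow> real \<Rightarrow> bool" where
  "rotates_plane f P \<theta> \<longleftrightarrow> (\<exists>a\<in>vectors. \<exists>b\<in>vectors.
     vdot a a = 1 \<and> vdot b b = 1 \<and> vdot a b = 0 \<and> P = span {a, b} \<and>
     (\<forall>s t. f (s *\<^sub>R a + t *\<^sub>R b) =
        (s * cos \<theta> - t * sin \<theta>) *\<^sub>R a + (s * sin \<theta> + t * cos \<theta>) *\<^sub>R b))"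

definition orthogonal_planes :: "cl8 set \<Rightarrow> cl8 set \<Rightarrow> bool" where
  "orthogonal_planes P Q \<longleftrightarrow> (\<forall>x\<in>P. \<forall>y\<in>Q. vdot x y = 0)"

section \<open>The $E_8$ Coxeter element\<close>

definition "\<alpha>1 = (1 / sqrt 2) *\<^sub>R (evec 7 - evec 6)"
definition "\<alpha>2 = (1 / sqrt 2) *\<^sub>R (evec 6 - evec 5)"
definition "\<alpha>3 = (1 / sqrt 2) *\<^sub>R (evec 5 - evec 4)"
definition "\<alpha>4 = (1 / sqrt 2) *\<^sub>R (evec 4 - evec 3)"
definition "\<alpha>5 = (1 / sqrt 2) *\<^sub>R (evec 3 - evec 2)"
definition "\<alpha>6 = (1 / sqrt 2) *\<^sub>R (evec 2 - evec 1)"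
definition "\<alpha>7 = (1 / sqrt 8) *\<^sub>R
  (evec 1 - evec 2 - evec 3 - evec 4 - evec 5 - evec 6 - evec 7 + evec 8)"
definition "\<alpha>8 = (1 / sqrt 2) *\<^sub>R (evec 2 + evec 1)"

definition coxeter_versor :: cl8 where
  "coxeter_versor = \<alpha>2 * \<alpha>4 * \<alpha>6 * \<alpha>8 * \<alpha>3 * \<alpha>5 * \<alpha>1 * \<alpha>7"

definition reflection :: "cl8 \<Rightarrow> cl8 \<Rightarrow> cl8" where
  "reflection a v = - (a * v * a)"

text \<open>
  Since \<open>w v\<close> is the reversed versor times \<open>v\<close> times the versor, the leftmost root of the
  versor is the one that reflects first.
\<close>

definition coxeter_element :: "cl8 \<Rightarrow> cl8" where
  "coxeter_element =
     reflection \<alpha>7 \<circ> reflection \<alpha>1 \<circ> reflection \<alpha>5 \<circ> reflection \<alpha>3 \<circ>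
     reflection \<alpha>8 \<circ> reflection \<alpha>6 \<circ> reflection \<alpha>4 \<circ> reflection \<alpha>2"

definition is_coxeter_plane :: "cl8 set \<Rightarrow> bool" where
  "is_coxeter_plane P \<longleftrightarrow> rotates_plane coxeter_element P (2 * pi / 30) \<and>
     (\<forall>Q. rotates_plane coxeter_element Q (2 * pi / 30) \<longrightarrow> Q = P)"

text \<open>
  The matrix of the Coxeter element with respect to \<open>e_1, \<dots>, e_8\<close>, over the complex numbers;
  matrix indices start at \<open>0\<close>.
\<close>

definition coxeter_matrix :: "complex mat" where
  "coxeter_matrix =
     mat 8 8 (\<lambda>(i, j). complex_of_real (coef (coxeter_element (evec (Suc j))) {Suc i}))"

definition exponents :: "nat set" where
  "exponents = {m. 0 < m \<and> m < 30 \<and>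
     eigenvalue coxeter_matrix (exp (2 * of_real pi * \<i> * of_nat m / 30))}"

section \<open>Rounded decimals\<close>

definition rounds_to :: "real \<Rightarrow> real \<Rightarrow> nat \<Rightarrow> bool" where
  "rounds_to x d k \<longleftrightarrow> of_int (round (x * 10 ^ k)) / 10 ^ k = d"

text \<open>
  An entry \<open>(i, d, k)\<close> of the table says that the coefficient of \<open>e_i\<close> is \<open>d\<close> when rounded to
  \<open>k\<close> decimal places; a coefficient without an entry is exactly \<open>0\<close>.
\<close>

definition vector_rounds_to :: "cl8 \<Rightarrow> (nat \<times> real \<times> nat) list \<Rightarrow> bool" where
  "vector_rounds_to v table \<longleftrightarrow> v \<in> vectors \<and>
     (\<forall>i\<in>{1..8}. case map_of table i of
        None \<Rightarrow> coef v {i} = 0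
      | Some (d, k) \<Rightarrow> rounds_to (coef v {i}) d k)"

end

theory Submission
  imports Defs
begin

text \<open>
  The Coxeter element \<open>f\<close> is an isometry of 8-dimensional space, so it is governed by its invariant
  planes. A plane turned by \<open>\<theta>\<close> consists of solutions of \<open>f (f x) + x = 2 cos \<theta> f x\<close>. For
  \<open>c = 2 cos (2 \<pi> k / 30)\<close> with \<open>k = 1, 7, 11, 13\<close>, the four roots of \<open>c^4 + c^3 - 4 c^2 - 4 c + 1\<close>,
  a solution \<open>x\<close> can be written down with coefficients polynomial in \<open>c\<close>
  (\<open>plane_vec_rotation_space\<close>), and \<open>x\<close>, \<open>f x\<close> span a plane on which \<open>f\<close> is the rotation
  (\<open>rotation_frame\<close>). Solutions for different \<open>c\<close> are orthogonal because \<open>f\<close> is an isometry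
  (\<open>rotation_space_orthogonal\<close>); hence the four planes together carry 8 orthonormal vectors and exhaust
  the space (\<open>vectors_span_axes\<close>). This yields the uniqueness of the Coxeter plane. The same 8 axes
  supply 8 distinct complex eigenvalues, which is all that an 8 by 8 matrix can have.

  The vectors of the theorem are positive multiples of \<open>x\<close> and of \<open>x + f x\<close>. The reason is that \<open>f\<close> is the
  product of two involutions, one for each class of mutually orthogonal simple roots; \<open>x\<close> is fixed by one
  of them and \<open>x + f x\<close> by the other. Normalising their outer product gives the unit bivector
  of the plane, with the orientation in which \<open>f\<close> turns by the positive angle \<open>2 \<pi> k / 30\<close>.

  The factorisation of the versor \<open>W\<close> is verified through its action on vectors. Conjugation by
  \<open>W\<close> and by the product of the four exponentials induces the same map \<open>f\<close> on vectors, so their quotient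
  commutes with all vectors. In even dimension such an element is a scalar (\<open>central_imp_scalar\<close>); it is
  \<open>1\<close> or \<open>- 1\<close> because both elements are inverted by reversal, and the sign is read off
  from the scalar parts, which are \<open>- 1 / 16\<close> for \<open>W\<close> and a product of positive cosines for the
  exponentials (\<open>versor_factorisation\<close>).

  The expansion of \<open>W\<close> is a finite computation with integers, carried out on binary trees that
  represent multivectors sparsely. The decimals follow from one good approximation of \<open>2 cos (\<pi> / 15)\<close>,
  since each of the other three traces is obtained from another one by \<open>c \<mapsto> 2 - c^2\<close>.
\<close>

section \<open>Vectors and their scalar product\<close>

definition vec8 :: "real \<Rightarrow> real \<Rightarrow> real \<Rightarrow> real \<Rightarrow> real \<Rightarrow> real \<Rightarrow> real \<Rightarrow> real \<Rightarrow> cl8" where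
  "vec8 x1 x2 x3 x4 x5 x6 x7 x8 =
     x1 *\<^sub>R evec 1 + x2 *\<^sub>R evec 2 + x3 *\<^sub>R evec 3 + x4 *\<^sub>R evec 4 +
     x5 *\<^sub>R evec 5 + x6 *\<^sub>R evec 6 + x7 *\<^sub>R evec 7 + x8 *\<^sub>R evec 8"

lemma one_to_eight:
  "{1..8::nat} = {1, 2, 3, 4, 5, 6, 7, 8}"
  "{Suc 0..8} = {1, 2, 3, 4, 5, 6, 7, 8}"
  by (auto simp: atLeastAtMost_iff)

lemma coef_vec8 [simp]:
  "coef (vec8 x1 x2 x3 x4 x5 x6 x7 x8) {1} = x1"
  "coef (vec8 x1 x2 x3 x4 x5 x6 x7 x8) {Suc 0} = x1"
  "coef (vec8 x1 x2 x3 x4 x5 x6 x7 x8) {2} = x2"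
  "coef (vec8 x1 x2 x3 x4 x5 x6 x7 x8) {3} = x3"
  "coef (vec8 x1 x2 x3 x4 x5 x6 x7 x8) {4} = x4"
  "coef (vec8 x1 x2 x3 x4 x5 x6 x7 x8) {5} = x5"
  "coef (vec8 x1 x2 x3 x4 x5 x6 x7 x8) {6} = x6"
  "coef (vec8 x1 x2 x3 x4 x5 x6 x7 x8) {7} = x7"
  "coef (vec8 x1 x2 x3 x4 x5 x6 x7 x8) {8} = x8"
  by (simp_all add: vec8_def coef_evec)

lemma vec8_linear:
  "vec8 x1 x2 x3 x4 x5 x6 x7 x8 + vec8 y1 y2 y3 y4 y5 y6 y7 y8 =
     vec8 (x1 + y1) (x2 + y2) (x3 + y3) (x4 + y4) (x5 + y5) (x6 + y6) (x7 + y7) (x8 + y8)"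
  "vec8 x1 x2 x3 x4 x5 x6 x7 x8 - vec8 y1 y2 y3 y4 y5 y6 y7 y8 =
     vec8 (x1 - y1) (x2 - y2) (x3 - y3) (x4 - y4) (x5 - y5) (x6 - y6) (x7 - y7) (x8 - y8)"
  "r *\<^sub>R vec8 x1 x2 x3 x4 x5 x6 x7 x8 =
     vec8 (r * x1) (r * x2) (r * x3) (r * x4) (r * x5) (r * x6) (r * x7) (r * x8)"
  by (simp_all add: vec8_def algebra_simps)

lemma evec_in_vectors: "i \<in> {1..8} \<Longrightarrow> evec i \<in> vectors"
  unfolding vectors_def by (intro span_base) simp

lemma vectors_lincomb [simp]:
  "0 \<in> vectors"
  "v \<in> vectors \<Longrightarrow> w \<in> vectors \<Longrightarrow> v + w \<in> vectors"
  "v \<in> vectors \<Longrightarrow> w \<in> vectors \<Longrightarrow> v - w \<in> vectors"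
  "v \<in> vectors \<Longrightarrow> r *\<^sub>R v \<in> vectors"
  by (simp_all add: vectors_def span_zero span_add span_diff span_scale)

lemma vec8_in_vectors [simp]: "vec8 x1 x2 x3 x4 x5 x6 x7 x8 \<in> vectors"
  by (simp add: vec8_def evec_in_vectors)

lemma vectors_induct [consumes 1, case_names evec zero lincomb]:
  assumes "v \<in> vectors"
    and "\<And>i. i \<in> {1..8} \<Longrightarrow> P (evec i)" "P 0"
    and "\<And>r v w. P v \<Longrightarrow> P w \<Longrightarrow> P (r *\<^sub>R v + w)"
  shows "P v"
  using assms(1) unfolding vectors_def
proof (induction rule: span_induct_alt)
  case base
  then show ?case by (rule assms(3))
next
  case (step c x y)
  then show ?case using assms(2,4) by auto
qed

lemma vec8_coef:
  assumes "v \<in> vectors"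
  shows "v = vec8 (coef v {1}) (coef v {2}) (coef v {3}) (coef v {4})
    (coef v {5}) (coef v {6}) (coef v {7}) (coef v {8})"
  using assms
proof (induction rule: vectors_induct)
  case (evec i)
  then have "i \<in> {1, 2, 3, 4, 5, 6, 7, 8}"
    by (simp only: one_to_eight)
  then show ?case
    by (auto simp: coef_evec vec8_def)
next
  case zero
  then show ?case by (simp add: vec8_def)
next
  case (lincomb r v w)
  show ?case
    by (subst lincomb(1), subst lincomb(2)) (simp add: vec8_linear)
qed

lemma vdot_coef: "vdot v w = (coef (v * w) {} + coef (w * v) {}) / 2"
  by (simp add: vdot_def)

lemma vdot_commute: "vdot v w = vdot w v"
  by (simp add: vdot_coef)

lemma vdot_linear [simp]:
  "vdot (u + v) w = vdot u w + vdot v w" "vdot w (u + v) = vdot w u + vdot w v"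
  "vdot (u - v) w = vdot u w - vdot v w" "vdot w (u - v) = vdot w u - vdot w v"
  "vdot (r *\<^sub>R v) w = r * vdot v w" "vdot w (r *\<^sub>R v) = r * vdot w v"
  "vdot (- v) w = - vdot v w" "vdot w (- v) = - vdot w v"
  "vdot 0 w = 0" "vdot w 0 = 0"
  by (simp_all add: vdot_coef algebra_simps add_divide_distrib diff_divide_distrib)

lemma vdot_evec [simp]:
  "i \<in> {1..8} \<Longrightarrow> j \<in> {1..8} \<Longrightarrow> vdot (evec i) (evec j) = (if i = j then 1 else 0)"
  by (cases "i = j") (simp_all add: vdot_coef evec_square evec_anticommute[of i j])

lemma vdot_vec8:
  "vdot (vec8 x1 x2 x3 x4 x5 x6 x7 x8) (vec8 y1 y2 y3 y4 y5 y6 y7 y8) =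
     x1 * y1 + x2 * y2 + x3 * y3 + x4 * y4 + x5 * y5 + x6 * y6 + x7 * y7 + x8 * y8"
  by (simp add: vec8_def)

lemma vdot_pos:
  assumes "v \<in> vectors" "v \<noteq> 0"
  shows "vdot v v > 0"
proof (rule ccontr)
  assume neg: "\<not> vdot v v > 0"
  let ?c = "\<lambda>i. coef v {i}"
  have "vdot v v = (\<Sum>i\<in>{1..8}. (?c i)\<^sup>2)"
    using vdot_vec8[of "?c 1" "?c 2" "?c 3" "?c 4" "?c 5" "?c 6" "?c 7" "?c 8"
        "?c 1" "?c 2" "?c 3" "?c 4" "?c 5" "?c 6" "?c 7" "?c 8"]
    unfolding vec8_coef[OF assms(1), symmetric]
    by (simp add: one_to_eight power2_eq_square)
  moreover have "0 \<le> (\<Sum>i\<in>{1..8}. (?c i)\<^sup>2)"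
    by (rule sum_nonneg) simp
  ultimately have "(\<Sum>i\<in>{1..8}. (?c i)\<^sup>2) = 0"
    using neg by linarith
  then have "\<forall>i\<in>{1..8}. ?c i = 0"
    by (subst (asm) sum_nonneg_eq_0_iff) auto
  then have "v = 0"
    by (subst vec8_coef[OF assms(1)]) (simp add: one_to_eight vec8_def)
  with assms(2) show False by simp
qed

lemma anticommutator:
  assumes "v \<in> vectors" "w \<in> vectors"
  shows "v * w + w * v = (2 * vdot v w) *\<^sub>R 1"
proof -
  have "\<exists>r. v * w + w * v = r *\<^sub>R 1"
    using assms(1)
  proof (induction rule: vectors_induct)
    case (evec i)
    show ?case using assms(2)
    proof (induction rule: vectors_induct)
      case (evec j)
      show ?case
      proof (cases "i = j")
        case True
        then have "evec i * evec j + evec j * evec i = 2 *\<^sub>R 1"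
          using evec by (simp add: evec_square scaleR_2)
        then show ?thesis ..
      next
        case False
        then have "evec i * evec j + evec j * evec i = 0 *\<^sub>R 1"
          using evec \<open>i \<in> _\<close> by (subst evec_anticommute) auto
        then show ?thesis ..
      qed
    next
      case zero
      show ?case by (rule exI[of _ 0]) simp
    next
      case (lincomb r v w)
      then obtain s t where st: "evec i * v + v * evec i = s *\<^sub>R 1" "evec i * w + w * evec i = t *\<^sub>R 1"
        by blast
      have "evec i * (r *\<^sub>R v + w) + (r *\<^sub>R v + w) * evec i =
          r *\<^sub>R (evec i * v + v * evec i) + (evec i * w + w * evec i)"
        by (simp add: algebra_simps)
      also have "\<dots> = (r * s + t) *\<^sub>R 1"
        unfolding st by (simp add: algebra_simps)
      finally show ?case ..
    qed
  next
    case zero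
    show ?case by (rule exI[of _ 0]) simp
  next
    case (lincomb r u v)
    then obtain s t where st: "u * w + w * u = s *\<^sub>R 1" "v * w + w * v = t *\<^sub>R 1"
      by blast
    have "(r *\<^sub>R u + v) * w + w * (r *\<^sub>R u + v) =
        r *\<^sub>R (u * w + w * u) + (v * w + w * v)"
      by (simp add: algebra_simps)
    also have "\<dots> = (r * s + t) *\<^sub>R 1"
      unfolding st by (simp add: algebra_simps)
    finally show ?case ..
  qed
  then obtain r where r: "v * w + w * v = r *\<^sub>R 1" ..
  have "2 * vdot v w = r"
    by (simp add: vdot_def r)
  with r show ?thesis by simp
qed

lemma vector_square: "v \<in> vectors \<Longrightarrow> v * v = vdot v v *\<^sub>R 1"
  using anticommutator[of v v] by (simp flip: scaleR_2 scaleR_scaleR)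

lemma orthogonal_anticommute:
  assumes "v \<in> vectors" "w \<in> vectors" "vdot v w = 0"
  shows "w * v = - (v * w)"
  using anticommutator[OF assms(1,2)] assms(3) by (simp add: eq_neg_iff_add_eq_0 add.commute)

lemma independent_orthonormal:
  assumes "finite S" "\<And>v w. v \<in> S \<Longrightarrow> w \<in> S \<Longrightarrow> vdot v w = (if v = w then 1 else 0)"
  shows "independent S"
proof (rule real_vector.independent_if_scalars_zero[OF assms(1)])
  fix u w
  assume sum: "(\<Sum>v\<in>S. u v *\<^sub>R v) = 0" and w: "w \<in> S"
  have "vdot (\<Sum>v\<in>T. u v *\<^sub>R v) w = (\<Sum>v\<in>T. u v * vdot v w)" if "finite T" for T
    using that by (induction T) auto
  then have "0 = (\<Sum>v\<in>S. u v * vdot v w)"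
    using sum assms(1) by (metis vdot_linear(9))
  also have "\<dots> = (\<Sum>v\<in>S. if v = w then u v else 0)"
    using w by (intro sum.cong refl) (simp add: assms(2))
  also have "\<dots> = u w"
    using w assms(1) by simp
  finally show "u w = 0" ..
qed

text \<open>
  An orthonormal set is independent, so one that lies in the span of no more vectors than it has itself
  cannot miss any of that span. It is used for the 8 axes inside the whole space and for 2 axes inside a
  plane.
\<close>

lemma orthonormal_spans:
  assumes "finite S" "\<And>v w. v \<in> S \<Longrightarrow> w \<in> S \<Longrightarrow> vdot v w = (if v = w then 1 else 0)"
    and "finite T" "S \<subseteq> span T" "card T \<le> card S"
  shows "span T = span S"
proof
  note ind = independent_orthonormal[OF assms(1,2)]
  show "span S \<subseteq> span T"
    by (rule span_minimal[OF assms(4) subspace_span])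
  have "T \<subseteq> span S"
  proof
    fix t assume t: "t \<in> T"
    show "t \<in> span S"
    proof (rule ccontr)
      assume nt: "t \<notin> span S"
      then have "t \<notin> S" by (meson span_base)
      have "independent (insert t S)"
        using ind nt by (simp add: independent_insert)
      moreover have "insert t S \<subseteq> span T"
        using t assms(4) by (auto intro: span_base)
      ultimately have "card (insert t S) \<le> card T"
        using independent_span_bound[OF assms(3)] by blast
      with assms(1,5) \<open>t \<notin> S\<close> show False by simp
    qed
  qed
  then show "span T \<subseteq> span S"
    by (rule span_minimal[OF _ subspace_span])
qed

section \<open>The Coxeter element in coordinates\<close>

lemma reflection_vector:
  assumes "a \<in> vectors" "v \<in> vectors" "vdot a a = 1"
  shows "reflection a v = v - (2 * vdot a v) *\<^sub>R a"
proof -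
  have "a * v * a = ((2 * vdot a v) *\<^sub>R 1 - v * a) * a"
    using anticommutator[OF assms(1,2)] by (simp flip: eq_diff_eq)
  also have "\<dots> = (2 * vdot a v) *\<^sub>R a - v * (a * a)"
    by (simp add: left_diff_distrib mult.assoc)
  also have "\<dots> = (2 * vdot a v) *\<^sub>R a - v"
    by (simp add: vector_square[OF assms(1)] assms(3))
  finally show ?thesis by (simp add: reflection_def)
qed

lemma reflection_in_vectors:
  "a \<in> vectors \<Longrightarrow> v \<in> vectors \<Longrightarrow> vdot a a = 1 \<Longrightarrow> reflection a v \<in> vectors"
  by (simp add: reflection_vector)

lemma roots_vec8:
  "\<alpha>1 = vec8 0 0 0 0 0 (- (1 / sqrt 2)) (1 / sqrt 2) 0"
  "\<alpha>2 = vec8 0 0 0 0 (- (1 / sqrt 2)) (1 / sqrt 2) 0 0"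
  "\<alpha>3 = vec8 0 0 0 (- (1 / sqrt 2)) (1 / sqrt 2) 0 0 0"
  "\<alpha>4 = vec8 0 0 (- (1 / sqrt 2)) (1 / sqrt 2) 0 0 0 0"
  "\<alpha>5 = vec8 0 (- (1 / sqrt 2)) (1 / sqrt 2) 0 0 0 0 0"
  "\<alpha>6 = vec8 (- (1 / sqrt 2)) (1 / sqrt 2) 0 0 0 0 0 0"
  "\<alpha>7 = vec8 (1 / sqrt 8) (- (1 / sqrt 8)) (- (1 / sqrt 8)) (- (1 / sqrt 8))
     (- (1 / sqrt 8)) (- (1 / sqrt 8)) (- (1 / sqrt 8)) (1 / sqrt 8)"
  "\<alpha>8 = vec8 (1 / sqrt 2) (1 / sqrt 2) 0 0 0 0 0 0"
  by (simp_all add: vec8_def \<alpha>1_def \<alpha>2_def \<alpha>3_def \<alpha>4_def \<alpha>5_def \<alpha>6_def \<alpha>7_def \<alpha>8_def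
      scaleR_diff_right scaleR_add_right)

lemma root_in_vectors [simp]:
  "\<alpha>1 \<in> vectors" "\<alpha>2 \<in> vectors" "\<alpha>3 \<in> vectors" "\<alpha>4 \<in> vectors"
  "\<alpha>5 \<in> vectors" "\<alpha>6 \<in> vectors" "\<alpha>7 \<in> vectors" "\<alpha>8 \<in> vectors"
  by (simp_all add: roots_vec8)

lemma unit_root [simp]:
  "vdot \<alpha>1 \<alpha>1 = 1" "vdot \<alpha>2 \<alpha>2 = 1" "vdot \<alpha>3 \<alpha>3 = 1" "vdot \<alpha>4 \<alpha>4 = 1"
  "vdot \<alpha>5 \<alpha>5 = 1" "vdot \<alpha>6 \<alpha>6 = 1" "vdot \<alpha>7 \<alpha>7 = 1" "vdot \<alpha>8 \<alpha>8 = 1"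
  by (simp_all add: roots_vec8 vdot_vec8)

lemma coxeter_vec8:
  "coxeter_element (vec8 x1 x2 x3 x4 x5 x6 x7 x8) =
     (let s = (x2 + x8 - x1 - x3 - x4 - x5 - x6 - x7) / 4
      in vec8 (- x1 - s) (x4 + s) (s - x2) (x6 + s) (x3 + s) (x7 + s) (x5 + s) (x8 - s))"
proof -
  have half: "1 / sqrt 2 * (1 / sqrt 2) = (1 / 2 :: real)" "1 / sqrt 8 * (1 / sqrt 8) = (1 / 8 :: real)"
    by simp_all
  have refl: "reflection (vec8 (c * a1) (c * a2) (c * a3) (c * a4) (c * a5) (c * a6) (c * a7) (c * a8))
      (vec8 y1 y2 y3 y4 y5 y6 y7 y8) =
      (let t = a1 * y1 + a2 * y2 + a3 * y3 + a4 * y4 + a5 * y5 + a6 * y6 + a7 * y7 + a8 * y8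
       in vec8 (y1 - 2 * d * t * a1) (y2 - 2 * d * t * a2) (y3 - 2 * d * t * a3) (y4 - 2 * d * t * a4)
         (y5 - 2 * d * t * a5) (y6 - 2 * d * t * a6) (y7 - 2 * d * t * a7) (y8 - 2 * d * t * a8))"
    if "c * c = d" "d * (a1\<^sup>2 + a2\<^sup>2 + a3\<^sup>2 + a4\<^sup>2 + a5\<^sup>2 + a6\<^sup>2 + a7\<^sup>2 + a8\<^sup>2) = 1"
    for c d a1 a2 a3 a4 a5 a6 a7 a8 y1 y2 y3 y4 y5 y6 y7 y8
  proof (subst reflection_vector)
    show "vdot (vec8 (c * a1) (c * a2) (c * a3) (c * a4) (c * a5) (c * a6) (c * a7) (c * a8))
      (vec8 (c * a1) (c * a2) (c * a3) (c * a4) (c * a5) (c * a6) (c * a7) (c * a8)) = 1"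
      using that(2) by (simp add: vdot_vec8 algebra_simps power2_eq_square flip: that(1))
  qed (simp_all add: vdot_vec8 vec8_linear algebra_simps Let_def flip: that(1))
  have r: "reflection \<alpha>1 (vec8 y1 y2 y3 y4 y5 y6 y7 y8) = vec8 y1 y2 y3 y4 y5 y7 y6 y8"
    "reflection \<alpha>2 (vec8 y1 y2 y3 y4 y5 y6 y7 y8) = vec8 y1 y2 y3 y4 y6 y5 y7 y8"
    "reflection \<alpha>3 (vec8 y1 y2 y3 y4 y5 y6 y7 y8) = vec8 y1 y2 y3 y5 y4 y6 y7 y8"
    "reflection \<alpha>4 (vec8 y1 y2 y3 y4 y5 y6 y7 y8) = vec8 y1 y2 y4 y3 y5 y6 y7 y8"
    "reflection \<alpha>5 (vec8 y1 y2 y3 y4 y5 y6 y7 y8) = vec8 y1 y3 y2 y4 y5 y6 y7 y8"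
    "reflection \<alpha>6 (vec8 y1 y2 y3 y4 y5 y6 y7 y8) = vec8 y2 y1 y3 y4 y5 y6 y7 y8"
    "reflection \<alpha>8 (vec8 y1 y2 y3 y4 y5 y6 y7 y8) = vec8 (- y2) (- y1) y3 y4 y5 y6 y7 y8"
    for y1 y2 y3 y4 y5 y6 y7 y8
    using refl[OF half(1), where ?a1.0 = 0 and ?a2.0 = 0 and ?a3.0 = 0 and ?a4.0 = 0 and ?a5.0 = 0
        and ?a6.0 = "-1" and ?a7.0 = 1 and ?a8.0 = 0]
      refl[OF half(1), where ?a1.0 = 0 and ?a2.0 = 0 and ?a3.0 = 0 and ?a4.0 = 0 and ?a5.0 = "-1"
        and ?a6.0 = 1 and ?a7.0 = 0 and ?a8.0 = 0]
      refl[OF half(1), where ?a1.0 = 0 and ?a2.0 = 0 and ?a3.0 = 0 and ?a4.0 = "-1" and ?a5.0 = 1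
        and ?a6.0 = 0 and ?a7.0 = 0 and ?a8.0 = 0]
      refl[OF half(1), where ?a1.0 = 0 and ?a2.0 = 0 and ?a3.0 = "-1" and ?a4.0 = 1 and ?a5.0 = 0
        and ?a6.0 = 0 and ?a7.0 = 0 and ?a8.0 = 0]
      refl[OF half(1), where ?a1.0 = 0 and ?a2.0 = "-1" and ?a3.0 = 1 and ?a4.0 = 0 and ?a5.0 = 0
        and ?a6.0 = 0 and ?a7.0 = 0 and ?a8.0 = 0]
      refl[OF half(1), where ?a1.0 = "-1" and ?a2.0 = 1 and ?a3.0 = 0 and ?a4.0 = 0 and ?a5.0 = 0
        and ?a6.0 = 0 and ?a7.0 = 0 and ?a8.0 = 0]
      refl[OF half(1), where ?a1.0 = 1 and ?a2.0 = 1 and ?a3.0 = 0 and ?a4.0 = 0 and ?a5.0 = 0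
        and ?a6.0 = 0 and ?a7.0 = 0 and ?a8.0 = 0]
    by (simp_all add: roots_vec8)
  have r7: "reflection \<alpha>7 (vec8 y1 y2 y3 y4 y5 y6 y7 y8) =
     (let s = (y1 - y2 - y3 - y4 - y5 - y6 - y7 + y8) / 4
      in vec8 (y1 - s) (y2 + s) (y3 + s) (y4 + s) (y5 + s) (y6 + s) (y7 + s) (y8 - s))"
    for y1 y2 y3 y4 y5 y6 y7 y8
    using refl[OF half(2), where ?a1.0 = 1 and ?a2.0 = "-1" and ?a3.0 = "-1" and ?a4.0 = "-1" and ?a5.0 = "-1"
        and ?a6.0 = "-1" and ?a7.0 = "-1" and ?a8.0 = 1]
    by (simp add: roots_vec8 Let_def)
  show ?thesis
    by (simp add: coxeter_element_def r r7 Let_def algebra_simps)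
qed

section \<open>Expansion of the Coxeter versor\<close>

fun blade_insert :: "nat \<Rightarrow> nat list \<Rightarrow> int \<times> nat list" where
  "blade_insert i [] = (1, [i])"
| "blade_insert i (j # js) =
     (if i < j then (1, i # j # js) else if i = j then (1, js)
      else let (s, l) = blade_insert i js in (- s, j # l))"

lemma eprod_Nil [simp]: "eprod [] = 1"
  and eprod_Cons: "eprod (i # is) = evec i * eprod is"
  and eprod_append: "eprod (is @ js) = eprod is * eprod js"
  by (simp_all add: eprod_def)

lemma eprod_snoc: "eprod (is @ [i]) = eprod is * evec i"
  by (simp add: eprod_append eprod_Cons)

lemma blade_insert_range:
  "blade_insert i is = (s, l) \<Longrightarrow> set l \<subseteq> insert i (set is)"
proof (induction "is" arbitrary: s l)
  case (Cons j js)
  then show ?case by (fastforce split: if_splits prod.splits)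
qed simp

lemma blade_insert_sorted:
  assumes "sorted_wrt (<) is"
  shows "sorted_wrt (<) (snd (blade_insert i is))"
  using assms
proof (induction "is")
  case (Cons j js)
  obtain s l where sl: "blade_insert i js = (s, l)" by fastforce
  from Cons sl blade_insert_range[OF sl] show ?case by (auto intro: less_trans)
qed simp

text \<open>
  One sign serves both products, since reversing all factors turns an exchange of neighbours into an
  exchange of neighbours. This is what makes reversal an antiautomorphism.
\<close>

lemma blade_insert:
  assumes "i \<in> {1..8}" "set is \<subseteq> {1..8}" "blade_insert i is = (s, l)"
  shows "evec i * eprod is = of_int s *\<^sub>R eprod l"
    and "eprod (rev is) * evec i = of_int s *\<^sub>R eprod (rev l)"
proof -
  have "evec i * eprod is = of_int s *\<^sub>R eprod l \<and>
        eprod (rev is) * evec i = of_int s *\<^sub>R eprod (rev l)"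
    using assms
  proof (induction "is" arbitrary: s l)
    case Nil
    then show ?case by (auto simp: eprod_Cons)
  next
    case (Cons j js)
    obtain t m where tm: "blade_insert i js = (t, m)" by fastforce
    have IH: "evec i * eprod js = of_int t *\<^sub>R eprod m"
        "eprod (rev js) * evec i = of_int t *\<^sub>R eprod (rev m)"
      using Cons.IH[OF Cons.prems(1) _ tm] Cons.prems(2) by auto
    consider "i < j" | "i = j" | "j < i" by linarith
    then show ?case
    proof cases
      case 1
      then show ?thesis using Cons.prems(3) by (auto simp: eprod_Cons eprod_snoc eprod_append mult.assoc)
    next
      case 2
      then show ?thesis
        using Cons.prems by (auto simp: eprod_Cons eprod_snoc evec_square mult.assoc
            simp flip: mult.assoc[of "evec j" "evec j"])
    next
      case 3
      then have sl: "s = - t" "l = j # m" using Cons.prems(3) tm by auto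
      have ac: "evec i * evec j = - (evec j * evec i)"
        using 3 Cons.prems by (intro evec_anticommute) auto
      have "evec i * eprod (j # js) = - (evec j * (evec i * eprod js))"
        using ac by (simp add: eprod_Cons flip: mult.assoc)
      moreover have "eprod (rev (j # js)) * evec i = - (eprod (rev js) * evec i * evec j)"
        using ac by (simp add: eprod_snoc mult.assoc)
      ultimately show ?thesis
        unfolding IH sl by (simp add: eprod_Cons eprod_snoc)
    qed
  qed
  then show "evec i * eprod is = of_int s *\<^sub>R eprod l"
    "eprod (rev is) * evec i = of_int s *\<^sub>R eprod (rev l)" by simp_all
qed

definition blade_sum :: "(nat list \<times> int) list \<Rightarrow> cl8" where
  "blade_sum m = (\<Sum>(l, c)\<leftarrow>m. of_int c *\<^sub>R eprod l)"

text \<open>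
  Folding from the left produces the sum with the bracketing of an ordinary infix expression.
\<close>

lemma blade_sum_foldl: "blade_sum m = foldl (\<lambda>x (l, c). x + of_int c *\<^sub>R eprod l) 0 m"
  unfolding blade_sum_def
proof (induction m rule: rev_induct)
  case (snoc t m)
  then show ?case by (cases t) simp
qed simp

text \<open>
  At depth \<open>k\<close> the tree \<open>Node a b\<close> stands for \<open>a + e_k b\<close>, where \<open>a\<close> and \<open>b\<close> only involve generators
  of index greater than \<open>k\<close>. Multiplication by a generator then reaches its level by structural
  recursion, collecting one sign for each smaller generator, and addition merges equal blades without
  any search.
\<close>

datatype mv_tree = Zero | Scalar int | Node mv_tree mv_tree

fun tree_value :: "nat \<Rightarrow> mv_tree \<Rightarrow> cl8" where
  "tree_value k Zero = 0"
| "tree_value k (Scalar c) = of_int c *\<^sub>R 1"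
| "tree_value k (Node a b) = tree_value (Suc k) a + evec k * tree_value (Suc k) b"

fun tree_add :: "mv_tree \<Rightarrow> mv_tree \<Rightarrow> mv_tree" where
  "tree_add Zero t = t"
| "tree_add t Zero = t"
| "tree_add (Scalar c) (Scalar d) = Scalar (c + d)"
| "tree_add (Scalar c) (Node a b) = Node (tree_add (Scalar c) a) b"
| "tree_add (Node a b) (Scalar c) = Node (tree_add a (Scalar c)) b"
| "tree_add (Node a b) (Node c d) = Node (tree_add a c) (tree_add b d)"

fun tree_scale :: "int \<Rightarrow> mv_tree \<Rightarrow> mv_tree" where
  "tree_scale r Zero = Zero"
| "tree_scale r (Scalar c) = Scalar (r * c)"
| "tree_scale r (Node a b) = Node (tree_scale r a) (tree_scale r b)"

fun tree_evec :: "nat \<Rightarrow> mv_tree \<Rightarrow> mv_tree" where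
  "tree_evec d Zero = Zero"
| "tree_evec 0 (Scalar c) = Node Zero (Scalar c)"
| "tree_evec 0 (Node a b) = Node b a"
| "tree_evec (Suc d) (Scalar c) = Node (tree_evec d (Scalar c)) Zero"
| "tree_evec (Suc d) (Node a b) = Node (tree_evec d a) (tree_scale (- 1) (tree_evec d b))"

fun tree_zero :: "mv_tree \<Rightarrow> bool" where
  "tree_zero Zero \<longleftrightarrow> True"
| "tree_zero (Scalar c) \<longleftrightarrow> c = 0"
| "tree_zero (Node a b) \<longleftrightarrow> tree_zero a \<and> tree_zero b"

lemma tree_value_add: "tree_value k (tree_add s t) = tree_value k s + tree_value k t"
  by (induction s t arbitrary: k rule: tree_add.induct) (simp_all add: algebra_simps)

lemma tree_value_scale: "tree_value k (tree_scale r t) = of_int r *\<^sub>R tree_value k t"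
  by (induction t arbitrary: k) (simp_all add: algebra_simps)

lemma tree_value_zero: "tree_zero t \<Longrightarrow> tree_value k t = 0"
  by (induction t arbitrary: k) simp_all

lemma tree_value_evec:
  assumes "0 < k" "k + d \<le> 8"
  shows "tree_value k (tree_evec d t) = evec (k + d) * tree_value k t"
  using assms
proof (induction d t arbitrary: k rule: tree_evec.induct)
  case (3 a b)
  have "evec k * (evec k * x) = x" for x
    using 3 by (simp add: evec_square flip: mult.assoc)
  then show ?case by (simp add: distrib_left)
next
  case (5 d a b)
  have "evec (k + Suc d) * evec k = - (evec k * evec (k + Suc d))"
    using 5 by (intro evec_anticommute) auto
  then have "evec (k + Suc d) * (evec k * x) = - (evec k * (evec (k + Suc d) * x))" for x
    by (simp flip: mult.assoc)
  with 5 show ?case by (simp add: tree_value_scale distrib_left)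
qed auto

definition tree_of_blade :: "nat list \<Rightarrow> mv_tree" where
  "tree_of_blade l = foldr (\<lambda>i. tree_evec (i - 1)) l (Scalar 1)"

definition tree_of_terms :: "(nat list \<times> int) list \<Rightarrow> mv_tree" where
  "tree_of_terms m = foldr (\<lambda>(l, c). tree_add (tree_scale c (tree_of_blade l))) m Zero"

definition tree_vector_times :: "(nat \<times> int) list \<Rightarrow> mv_tree \<Rightarrow> mv_tree" where
  "tree_vector_times v t = foldr (\<lambda>(i, a). tree_add (tree_scale a (tree_evec (i - 1) t))) v Zero"

lemma tree_value_blade:
  "set l \<subseteq> {1..8} \<Longrightarrow> tree_value 1 (tree_of_blade l) = eprod l"
  unfolding tree_of_blade_def by (induction l) (auto simp: tree_value_evec eprod_Cons)

lemma tree_value_terms: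
  "\<forall>(l, c)\<in>set m. set l \<subseteq> {1..8} \<Longrightarrow> tree_value 1 (tree_of_terms m) = blade_sum m"
  unfolding tree_of_terms_def blade_sum_def
  by (induction m) (auto simp: tree_value_add tree_value_scale tree_value_blade simp del: One_nat_def)

lemma tree_value_vector_times:
  "\<forall>(i, a)\<in>set v. i \<in> {1..8} \<Longrightarrow>
    tree_value 1 (tree_vector_times v t) = (\<Sum>(i, a)\<leftarrow>v. of_int a *\<^sub>R evec i) * tree_value 1 t"
  unfolding tree_vector_times_def
  by (induction v) (auto simp: tree_value_add tree_value_scale tree_value_evec distrib_right)

lemma tree_value_product:
  assumes "\<forall>v\<in>set vs. \<forall>(i, a)\<in>set v. i \<in> {1..8}"
  shows "tree_value 1 (foldr tree_vector_times vs (Scalar 1)) =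
    prod_list (map (\<lambda>v. \<Sum>(i, a)\<leftarrow>v. of_int a *\<^sub>R evec i) vs)"
  using assms by (induction vs) (simp_all add: tree_value_vector_times del: One_nat_def atLeastAtMost_iff)

text \<open>
  The simple roots in the order of the versor, cleared of their denominators: seven factors \<open>\<surd>2\<close> and one
  \<open>\<surd>8\<close>, which together give \<open>32\<close>.
\<close>

definition scaled_roots :: "(nat \<times> int) list list" where
  "scaled_roots =
     [[(6, 1), (5, - 1)], [(4, 1), (3, - 1)], [(2, 1), (1, - 1)], [(2, 1), (1, 1)],
      [(5, 1), (4, - 1)], [(3, 1), (2, - 1)], [(7, 1), (6, - 1)],
      [(1, 1), (2, - 1), (3, - 1), (4, - 1), (5, - 1), (6, - 1), (7, - 1), (8, 1)]]"

definition versor_terms :: "(nat list \<times> int) list" where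
  "versor_terms = [
     ([], - 1), ([2, 3, 4, 5, 6, 7], 1), ([1, 2, 3, 4, 5, 6, 7, 8], 1),
     ([1, 4, 5, 6, 7, 8], - 1), ([1, 2, 3, 6, 7, 8], - 1), ([4, 5, 6, 7], - 1),
     ([2, 3, 6, 7], - 1), ([1, 6, 7, 8], 1), ([1, 2, 5, 6, 7, 8], 1), ([6, 7], 1),
     ([2, 5, 6, 7], 1), ([1, 3, 5, 6, 7, 8], 1), ([1, 2, 4, 6, 7, 8], - 1), ([3, 5, 6, 7], 1),
     ([2, 4, 6, 7], - 1), ([1, 3, 4, 6, 7, 8], - 1), ([3, 4, 6, 7], - 1), ([1, 3, 4, 8], 1),
     ([3, 4], 1), ([1, 2, 3, 4, 7, 8], 1), ([1, 4, 7, 8], - 1), ([2, 3, 4, 7], 1),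
     ([1, 2, 3, 5, 7, 8], 1), ([4, 7], - 1), ([2, 3, 5, 7], 1), ([1, 5, 7, 8], - 1),
     ([5, 7], - 1), ([1, 5, 6, 7], - 2), ([1, 5, 6, 8], 1), ([1, 2, 7, 8], 1), ([5, 6], 1),
     ([1, 3, 7, 8], 1), ([3, 7], 1), ([2, 4, 5, 7], 1), ([1, 3, 4, 5, 7, 8], 1),
     ([1, 3, 4, 7], 2), ([1, 3, 4, 5, 6, 8], - 1), ([3, 4, 5, 7], 1), ([1, 3, 4, 5, 6, 7], 6),
     ([3, 4, 5, 6], - 1), ([1, 2, 4, 5, 6, 7], 4), ([1, 2, 4, 5, 6, 8], - 1),
     ([1, 2, 6, 8], - 1), ([2, 4, 5, 6], - 1), ([1, 2, 6, 7], 2), ([1, 2, 3, 5, 6, 8], - 1),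
     ([2, 7], 1), ([1, 7], 2), ([1, 8], - 1), ([2, 6], - 1), ([1, 2, 3, 5, 6, 7], 4),
     ([2, 3, 5, 6], - 1), ([1, 2, 3, 4, 6, 7], 2), ([1, 2, 3, 4, 6, 8], - 1),
     ([2, 3, 4, 6], - 1), ([1, 2, 4, 8], 1), ([2, 4], 1), ([1, 2, 5, 8], - 1),
     ([1, 2, 5, 7], 2), ([2, 5], - 1), ([1, 2, 3, 8], 1), ([2, 3], 1),
     ([1, 2, 3, 4, 5, 8], - 1), ([1, 2, 3, 4, 5, 7], 2), ([1, 4, 6, 8], 1),
     ([2, 3, 4, 5], - 1), ([1, 2, 4, 5, 7, 8], 1), ([1, 4, 6, 7], - 4), ([1, 3, 6, 8], - 1),
     ([1, 4, 5, 8], 1), ([1, 3, 5, 7], 4), ([1, 3, 5, 8], - 1), ([1, 4, 5, 6], - 2),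
     ([1, 3, 5, 6], - 2), ([1, 3, 4, 6], - 4), ([1, 4], 2), ([1, 3], 2), ([1, 3, 4, 5], - 4),
     ([1, 2, 4, 6], - 2), ([1, 2, 3, 6], - 2), ([1, 2, 4, 5], - 2), ([1, 2, 3, 5], - 2),
     ([4, 6], 1), ([4, 5], 1), ([3, 6], - 1), ([3, 5], - 1)]"

lemma coxeter_versor_terms: "coxeter_versor = (1 / 16) *\<^sub>R blade_sum versor_terms"
proof -
  let ?r = "1 / sqrt 2 :: real"
  have "sqrt 8 = sqrt (2 * 2 * 2 :: real)" by simp
  then have s8: "sqrt 8 = 2 * sqrt 2" by (simp only: real_sqrt_mult) simp
  have "?r * (?r * (?r * (?r * (?r * (?r * (?r * (1 / sqrt 8))))))) = 1 / 32"
    unfolding s8 by (simp add: field_simps)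
  moreover have roots: "map (\<lambda>v. \<Sum>(i, a)\<leftarrow>v. of_int a *\<^sub>R evec i) scaled_roots =
      [evec 6 - evec 5, evec 4 - evec 3, evec 2 - evec 1, evec 2 + evec 1,
       evec 5 - evec 4, evec 3 - evec 2, evec 7 - evec 6,
       evec 1 - evec 2 - evec 3 - evec 4 - evec 5 - evec 6 - evec 7 + evec 8]"
    unfolding scaled_roots_def by (simp add: algebra_simps)
  moreover have "coxeter_versor = (?r * (?r * (?r * (?r * (?r * (?r * (?r * (1 / sqrt 8)))))))) *\<^sub>R
      prod_list (map (\<lambda>v. \<Sum>(i, a)\<leftarrow>v. of_int a *\<^sub>R evec i) scaled_roots)"
    unfolding coxeter_versor_def \<alpha>1_def \<alpha>2_def \<alpha>3_def \<alpha>4_def \<alpha>5_def \<alpha>6_def \<alpha>7_def \<alpha>8_def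
      mult_scaleR_left mult_scaleR_right scaleR_scaleR
    unfolding roots by (simp add: mult.assoc mult.left_commute[where 'a=real] del: mult_scaleR_left mult_scaleR_right)
  ultimately have "coxeter_versor = (1 / 32) *\<^sub>R tree_value 1 (foldr tree_vector_times scaled_roots (Scalar 1))"
    by (subst tree_value_product) (auto simp: scaled_roots_def)
  also have "tree_value 1 (foldr tree_vector_times scaled_roots (Scalar 1)) =
      2 *\<^sub>R tree_value 1 (tree_of_terms versor_terms)"
  proof -
    \<comment> \<open>Equal multivectors may have different trees, so the difference is tested for vanishing.\<close>
    have "tree_zero (tree_add (foldr tree_vector_times scaled_roots (Scalar 1))
        (tree_scale (- 2) (tree_of_terms versor_terms)))"
      by code_simp
    from tree_value_zero[OF this] show ?thesis
      by (simp add: tree_value_add tree_value_scale)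
  qed
  also have "tree_value 1 (tree_of_terms versor_terms) = blade_sum versor_terms"
    by (rule tree_value_terms) (simp add: versor_terms_def)
  finally show ?thesis by simp
qed

lemma numeral_times_cl8: "numeral n * x = numeral n *\<^sub>R (x :: cl8)"
  by (metis mult_scaleR_left mult_1 of_real_def of_real_numeral)

lemma coxeter_versor_expansion:
   "coxeter_versor = (1/16) *\<^sub>R
       (- 1 + eprod [2,3,4,5,6,7] + eprod [1,2,3,4,5,6,7,8] - eprod [1,4,5,6,7,8]
        - eprod [1,2,3,6,7,8] - eprod [4,5,6,7] - eprod [2,3,6,7] + eprod [1,6,7,8]
        + eprod [1,2,5,6,7,8] + eprod [6,7] + eprod [2,5,6,7] + eprod [1,3,5,6,7,8]
        - eprod [1,2,4,6,7,8] + eprod [3,5,6,7] - eprod [2,4,6,7] - eprod [1,3,4,6,7,8]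
        - eprod [3,4,6,7] + eprod [1,3,4,8] + eprod [3,4] + eprod [1,2,3,4,7,8] - eprod [1,4,7,8]
        + eprod [2,3,4,7] + eprod [1,2,3,5,7,8] - eprod [4,7] + eprod [2,3,5,7] - eprod [1,5,7,8]
        - eprod [5,7] - 2 * eprod [1,5,6,7] + eprod [1,5,6,8] + eprod [1,2,7,8] + eprod [5,6]
        + eprod [1,3,7,8] + eprod [3,7] + eprod [2,4,5,7] + eprod [1,3,4,5,7,8] + 2 * eprod [1,3,4,7]
        - eprod [1,3,4,5,6,8] + eprod [3,4,5,7] + 6 * eprod [1,3,4,5,6,7] - eprod [3,4,5,6]
        + 4 * eprod [1,2,4,5,6,7] - eprod [1,2,4,5,6,8] - eprod [1,2,6,8] - eprod [2,4,5,6]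
        + 2 * eprod [1,2,6,7] - eprod [1,2,3,5,6,8] + eprod [2,7] + 2 * eprod [1,7] - eprod [1,8]
        - eprod [2,6] + 4 * eprod [1,2,3,5,6,7] - eprod [2,3,5,6] + 2 * eprod [1,2,3,4,6,7]
        - eprod [1,2,3,4,6,8] - eprod [2,3,4,6] + eprod [1,2,4,8] + eprod [2,4] - eprod [1,2,5,8]
        + 2 * eprod [1,2,5,7] - eprod [2,5] + eprod [1,2,3,8] + eprod [2,3] - eprod [1,2,3,4,5,8]
        + 2 * eprod [1,2,3,4,5,7] + eprod [1,4,6,8] - eprod [2,3,4,5] + eprod [1,2,4,5,7,8]
        - 4 * eprod [1,4,6,7] - eprod [1,3,6,8] + eprod [1,4,5,8] + 4 * eprod [1,3,5,7]
        - eprod [1,3,5,8] - 2 * eprod [1,4,5,6] - 2 * eprod [1,3,5,6] - 4 * eprod [1,3,4,6]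
        + 2 * eprod [1,4] + 2 * eprod [1,3] - 4 * eprod [1,3,4,5] - 2 * eprod [1,2,4,6]
        - 2 * eprod [1,2,3,6] - 2 * eprod [1,2,4,5] - 2 * eprod [1,2,3,5] + eprod [4,6] + eprod [4,5]
        - eprod [3,6] - eprod [3,5])"
  unfolding coxeter_versor_terms blade_sum_foldl versor_terms_def
  by (simp add: numeral_times_cl8)

section \<open>Reversal, scalar part and centre\<close>

lemma coef_sum: "coef (sum f S) C = (\<Sum>A\<in>S. coef (f A) C)"
  by (induction S rule: infinite_finite_induct) auto

lemma reversal_linear [simp]:
  "reversal (x + y) = reversal x + reversal y"
  "reversal (x - y) = reversal x - reversal y"
  "reversal (r *\<^sub>R x) = r *\<^sub>R reversal x"
  "reversal 0 = 0"
  by (simp_all add: reversal_def scaleR_add_left scaleR_diff_left sum.distrib sum_subtractf scaleR_sum_right)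

lemma reversal_sum: "reversal (sum f S) = (\<Sum>A\<in>S. reversal (f A))"
  by (induction S rule: infinite_finite_induct) auto

lemma reversal_eprod:
  assumes "sorted_wrt (<) is" "set is \<subseteq> {1..8}"
  shows "reversal (eprod is) = eprod (rev is)"
proof -
  have "reversal (eprod is) = (\<Sum>A\<in>blades. if set is = A then eprod (rev (sorted_list_of_set A)) else 0)"
    unfolding reversal_def by (intro sum.cong refl) (simp add: coef_eprod[OF assms])
  also have "\<dots> = eprod (rev (sorted_list_of_set (set is)))"
    using assms(2) by (subst sum.delta') auto
  also have "sorted_list_of_set (set is) = is"
    using assms(1) by (simp add: strict_sorted_equal)
  finally show ?thesis .
qed

lemma reversal_one [simp]: "reversal 1 = 1"
  using reversal_eprod[of "[]"] by simp

text \<open>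
  Versors and rotors are linear combinations of products of vectors, so they can be reversed one vector
  at a time.
\<close>

lemma reversal_vector_times:
  assumes "v \<in> vectors"
  shows "reversal (v * x) = reversal x * v"
  using assms
proof (induction rule: vectors_induct)
  case (evec i)
  have blade: "reversal (evec i * eprod (sorted_list_of_set A)) = eprod (rev (sorted_list_of_set A)) * evec i"
    if "A \<in> blades" for A
  proof -
    let ?l = "sorted_list_of_set A"
    have "finite A" using that finite_subset by auto
    then have l: "set ?l \<subseteq> {1..8}" "sorted_wrt (<) ?l" using that by auto
    obtain s m where sm: "blade_insert i ?l = (s, m)" by fastforce
    have m: "sorted_wrt (<) m" "set m \<subseteq> {1..8}"
      using blade_insert_sorted[OF l(2), of i] blade_insert_range[OF sm] sm evec l by auto
    show ?thesis
      using blade_insert[OF evec l(1) sm] by (simp add: reversal_eprod[OF m])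
  qed
  have "reversal (evec i * x) = reversal (\<Sum>A\<in>blades. coef x A *\<^sub>R (evec i * eprod (sorted_list_of_set A)))"
    by (subst cl8_expansion[of x]) (simp add: sum_distrib_left)
  also have "\<dots> = (\<Sum>A\<in>blades. coef x A *\<^sub>R (eprod (rev (sorted_list_of_set A)) * evec i))"
    unfolding reversal_sum by (intro sum.cong refl) (simp add: blade)
  also have "\<dots> = reversal x * evec i"
    by (simp add: reversal_def sum_distrib_right)
  finally show ?case .
next
  case zero
  then show ?case by simp
next
  case (lincomb r v w)
  then show ?case by (simp add: distrib_left distrib_right)
qed

lemma reversal_vector: "v \<in> vectors \<Longrightarrow> reversal v = v"
  using reversal_vector_times[of v 1] by simp

text \<open>
  Two blades have a product with nonzero scalar part only if they are equal, so the scalar part is a trace.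
\<close>

lemma scalar_part_commute: "coef (x * y) {} = coef (y * x) {}"
proof -
  have "coef (u * v) {} = (\<Sum>A\<in>blades. blade_sign A A * coef u A * coef v A)" for u v
    unfolding coef_times
  proof (intro sum.cong refl)
    fix A :: "nat set" assume A: "A \<in> blades"
    have "sym_diff A B = {} \<longleftrightarrow> A = B" for B by blast
    then show "(\<Sum>B\<in>blades. if sym_diff A B = {} then blade_sign A B * coef u A * coef v B else 0) =
        blade_sign A A * coef u A * coef v A"
      using A by (simp add: sum_blades_delta cong: if_cong)
  qed
  then show ?thesis by (simp add: algebra_simps)
qed

lemma coef_times_evec:
  assumes "i \<in> {1..8}" "A \<subseteq> {1..8}"
  shows "coef (x * evec i) (sym_diff {i} A) = blade_sign A {i} * coef x A"
proof -
  have "coef (x * evec i) (sym_diff {i} A) = (\<Sum>B\<in>blades. if A = B then blade_sign B {i} * coef x B else 0)"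
    unfolding coef_times
  proof (intro sum.cong refl)
    fix B :: "nat set" assume "B \<in> blades"
    have flip: "sym_diff B D = sym_diff {i} A \<longleftrightarrow> D = sym_diff B (sym_diff {i} A)" for D
      by blast
    have single: "sym_diff B (sym_diff {i} A) = {i} \<longleftrightarrow> A = B"
      by blast
    have "(\<Sum>D\<in>blades. if sym_diff B D = sym_diff {i} A then blade_sign B D * coef x B * coef (evec i) D else 0) =
      (\<Sum>D\<in>blades. if {i} = D then (if A = B then blade_sign B D * coef x B else 0) else 0)"
      unfolding coef_evec[OF assms(1)] flip using single by (intro sum.cong refl) auto
    also have "\<dots> = (if A = B then blade_sign B {i} * coef x B else 0)"
      using assms(1) by (intro sum_blades_delta) auto
    finally show "(\<Sum>D\<in>blades. if sym_diff B D = sym_diff {i} A then blade_sign B D * coef x B * coef (evec i) D else 0) =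
      (if A = B then blade_sign B {i} * coef x B else 0)" .
  qed
  also have "\<dots> = blade_sign A {i} * coef x A"
    using assms(2) by (intro sum_blades_delta) auto
  finally show ?thesis .
qed

lemma blade_sign_swap:
  assumes "finite A"
  shows "blade_sign {i} A * blade_sign A {i} = (- 1) ^ card (A - {i})"
proof -
  have "blade_sign {i} A * blade_sign A {i} = (\<Prod>a\<in>A. if a = i then 1 else - 1)"
    by (auto simp: blade_sign_def prod.distrib[symmetric] intro!: prod.cong)
  also have "\<dots> = (\<Prod>a\<in>A - {i}. - 1)"
    using assms by (intro prod.mono_neutral_cong_right) auto
  finally show ?thesis by simp
qed

text \<open>
  Commuting with \<open>e_i\<close> kills the coefficient of every blade \<open>A\<close> that anticommutes with \<open>e_i\<close>, that is, for
  which \<open>A - {i}\<close> has odd size. A nonempty \<open>A\<close> of even size has such an \<open>i\<close> inside, one of odd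
  size has it outside, where the even dimension ensures that \<open>A\<close> is not the whole set.
\<close>

lemma central_imp_scalar:
  assumes "\<And>i. i \<in> {1..8} \<Longrightarrow> evec i * z = z * evec i"
  shows "z = coef z {} *\<^sub>R 1"
proof (rule cl8_eqI)
  fix A :: "nat set" assume A: "A \<subseteq> {1..8}"
  then have fin: "finite A" using finite_subset by auto
  show "coef z A = coef (coef z {} *\<^sub>R 1) A"
  proof (cases "A = {}")
    case False
    obtain i where i: "i \<in> {1..8}" "odd (card (A - {i}))"
    proof (cases "even (card A)")
      case True
      from False obtain i where "i \<in> A" by blast
      with True False fin A that[of i] show thesis
        by (simp add: card_gt_0_iff subset_iff)
    next
      case False
      then have "A \<noteq> {1..8}" by auto
      with A obtain i where "i \<in> {1..8}" "i \<notin> A" by blast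
      with False that[of i] show thesis by simp
    qed
    have inv: "sym_diff {i} (sym_diff {i} A) = A" by blast
    have "blade_sign {i} A * coef z A = coef (evec i * z) (sym_diff {i} A)"
      using coef_evec_times[OF i(1), of z "sym_diff {i} A"] unfolding inv by (rule sym)
    also have "\<dots> = blade_sign A {i} * coef z A"
      unfolding assms[OF i(1)] by (rule coef_times_evec[OF i(1) A])
    finally have "blade_sign {i} A * coef z A = blade_sign A {i} * coef z A" .
    moreover have "blade_sign {i} A * blade_sign A {i} = - 1"
      using blade_sign_swap[OF fin, of i] i(2) by simp
    then have "blade_sign {i} A \<noteq> blade_sign A {i}"
      by (metis not_one_le_zero zero_le_square neg_0_le_iff_le order.trans zero_le_one)
    ultimately show ?thesis using False by simp
  qed simp
qed

lemma reversal_coxeter_versor: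
  "reversal coxeter_versor = \<alpha>7 * \<alpha>1 * \<alpha>5 * \<alpha>3 * \<alpha>8 * \<alpha>6 * \<alpha>4 * \<alpha>2"
  by (simp add: coxeter_versor_def mult.assoc reversal_vector_times reversal_vector)

lemma coxeter_element_versor:
  "coxeter_element v = reversal coxeter_versor * v * coxeter_versor"
  unfolding reversal_coxeter_versor
  by (simp add: coxeter_element_def coxeter_versor_def reflection_def mult.assoc)

lemma coxeter_versor_unit: "coxeter_versor * reversal coxeter_versor = 1"
proof -
  have sq: "\<alpha>1 * \<alpha>1 = 1" "\<alpha>2 * \<alpha>2 = 1" "\<alpha>3 * \<alpha>3 = 1" "\<alpha>4 * \<alpha>4 = 1"
    "\<alpha>5 * \<alpha>5 = 1" "\<alpha>6 * \<alpha>6 = 1" "\<alpha>7 * \<alpha>7 = 1" "\<alpha>8 * \<alpha>8 = 1"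
    by (simp_all add: vector_square)
  have cancel: "x * a * (a * y) = x * y" if "a * a = 1" for a x y :: cl8
  proof -
    have "x * a * (a * y) = x * (a * a) * y" by (simp only: mult.assoc)
    then show ?thesis by (simp add: that)
  qed
  have "coxeter_versor * reversal coxeter_versor =
      \<alpha>2 * \<alpha>4 * \<alpha>6 * \<alpha>8 * \<alpha>3 * \<alpha>5 * \<alpha>1 * \<alpha>7 * (\<alpha>7 * (\<alpha>1 * (\<alpha>5 * (\<alpha>3 * (\<alpha>8 * (\<alpha>6 * (\<alpha>4 * \<alpha>2)))))))"
    unfolding reversal_coxeter_versor unfolding coxeter_versor_def by (simp only: mult.assoc)
  also have "\<dots> = 1"
    by (simp only: cancel sq)
  finally show ?thesis .
qed

section \<open>The four eigenplanes\<close>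

lemma coxeter_linear [simp]:
  "coxeter_element (v + w) = coxeter_element v + coxeter_element w"
  "coxeter_element (v - w) = coxeter_element v - coxeter_element w"
  "coxeter_element (r *\<^sub>R v) = r *\<^sub>R coxeter_element v"
  by (simp_all add: coxeter_element_versor algebra_simps)

lemma vdot_reflection:
  assumes "a \<in> vectors" "v \<in> vectors" "w \<in> vectors" "vdot a a = 1"
  shows "vdot (reflection a v) (reflection a w) = vdot v w"
  using assms by (simp add: reflection_vector vdot_commute[of v a] algebra_simps)

lemma coxeter_in_vectors [simp]: "v \<in> vectors \<Longrightarrow> coxeter_element v \<in> vectors"
  by (simp add: coxeter_element_def reflection_in_vectors)

lemma coxeter_isometry:
  "v \<in> vectors \<Longrightarrow> w \<in> vectors \<Longrightarrow> vdot (coxeter_element v) (coxeter_element w) = vdot v w"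
  by (simp add: coxeter_element_def reflection_in_vectors vdot_reflection)

text \<open>
  For an isometry \<open>f\<close> this is the kernel of the symmetric operator \<open>f + inv f - c\<close>, multiplied by \<open>f\<close> to
  avoid the inverse; it contains every plane on which \<open>f\<close> is a rotation of trace \<open>c\<close>.
\<close>

definition rotation_space :: "real \<Rightarrow> cl8 set" where
  "rotation_space c =
     {x \<in> vectors. coxeter_element (coxeter_element x) + x = c *\<^sub>R coxeter_element x}"

lemma rotation_space_vectors: "x \<in> rotation_space c \<Longrightarrow> x \<in> vectors"
  by (simp add: rotation_space_def)

lemma subspace_rotation_space: "subspace (rotation_space c)"
proof -
  define g where "g = (\<lambda>x. coxeter_element (coxeter_element x) + x - c *\<^sub>R coxeter_element x)"
  have g: "rotation_space c = {x \<in> vectors. g x = 0}"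
    by (auto simp: rotation_space_def g_def)
  have "g (x + y) = g x + g y" "g (r *\<^sub>R x) = r *\<^sub>R g x" "g 0 = 0" for x y r
    by (simp_all add: g_def algebra_simps coxeter_element_versor[of 0])
  then show ?thesis
    unfolding g by (intro subspaceI) auto
qed

lemma rotation_space_invariant: "x \<in> rotation_space c \<Longrightarrow> coxeter_element x \<in> rotation_space c"
  by (simp add: rotation_space_def flip: coxeter_linear)

text \<open>
  Eigenvectors of the symmetric operator \<open>f + inv f\<close> for distinct eigenvalues are orthogonal.
\<close>

lemma rotation_space_orthogonal:
  assumes x: "x \<in> rotation_space c" and y: "y \<in> rotation_space d" and "c \<noteq> d"
  shows "vdot x y = 0"
proof -
  let ?f = coxeter_element
  have v: "x \<in> vectors" "y \<in> vectors" "?f x \<in> vectors" "?f y \<in> vectors"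
    using x y by (simp_all add: rotation_space_def)
  have "c * vdot x y = vdot (?f (?f x) + x) (?f y)"
    using x v by (simp add: rotation_space_def coxeter_isometry)
  also have "\<dots> = vdot (?f x) (?f (?f y) + y)"
    using v by (simp add: coxeter_isometry)
  also have "\<dots> = d * vdot x y"
    using y v by (simp add: rotation_space_def coxeter_isometry)
  finally show ?thesis using \<open>c \<noteq> d\<close> by simp
qed

text \<open>
  Gram-Schmidt applied to \<open>x\<close>, \<open>f x\<close>. Since \<open>f\<close> is an isometry, \<open>f (f x) = 2 cos \<theta> f x - x\<close> forces
  the angle between \<open>x\<close> and \<open>f x\<close> to be \<open>\<theta>\<close>; the hypothesis on the sine fixes the orientation.
\<close>

lemma rotation_frame:
  fixes \<theta> :: real
  assumes x: "x \<in> rotation_space (2 * cos \<theta>)" and "x \<noteq> 0" and sin: "0 < sin \<theta>"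
  defines "n \<equiv> sqrt (vdot x x)"
  defines "a \<equiv> (1 / n) *\<^sub>R x"
  defines "b \<equiv> (1 / (n * sin \<theta>)) *\<^sub>R (coxeter_element x - cos \<theta> *\<^sub>R x)"
  shows "0 < n" "a \<in> rotation_space (2 * cos \<theta>)" "b \<in> rotation_space (2 * cos \<theta>)"
    and "vdot a a = 1" "vdot b b = 1" "vdot a b = 0"
    and "x = n *\<^sub>R a" "coxeter_element x = (n * cos \<theta>) *\<^sub>R a + (n * sin \<theta>) *\<^sub>R b"
    and "coxeter_element a = cos \<theta> *\<^sub>R a + sin \<theta> *\<^sub>R b"
    and "coxeter_element b = (- sin \<theta>) *\<^sub>R a + cos \<theta> *\<^sub>R b"
proof -
  let ?f = coxeter_element
  define y where "y = ?f x"
  have v: "x \<in> vectors" "y \<in> vectors"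
    using x by (simp_all add: rotation_space_def y_def)
  have fy: "?f y = (2 * cos \<theta>) *\<^sub>R y - x"
    using x by (simp add: rotation_space_def y_def eq_diff_eq)
  show n: "0 < n"
    using vdot_pos[OF v(1) \<open>x \<noteq> 0\<close>] by (simp add: n_def)
  have nn: "vdot x x = n * n"
    using n by (simp add: n_def)
  have yy: "vdot y y = n * n"
    using v by (simp add: y_def coxeter_isometry nn)
  have "vdot x y = vdot y (?f y)"
    using v by (simp add: coxeter_isometry y_def)
  then have xy: "vdot x y = cos \<theta> * (n * n)"
    unfolding fy by (simp add: yy vdot_commute[of y x])
  have b: "b = (1 / (n * sin \<theta>)) *\<^sub>R (y - cos \<theta> *\<^sub>R x)"
    by (simp add: b_def y_def)
  have y_space: "y \<in> rotation_space (2 * cos \<theta>)"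
    unfolding y_def by (rule rotation_space_invariant[OF x])
  note sub = subspace_rotation_space[of "2 * cos \<theta>"]
  show "a \<in> rotation_space (2 * cos \<theta>)"
    unfolding a_def by (rule subspace_scale[OF sub x])
  show "b \<in> rotation_space (2 * cos \<theta>)"
    unfolding b by (intro subspace_scale[OF sub] subspace_diff[OF sub] x y_space)
  show "vdot a a = 1" using n by (simp add: a_def nn)
  have "vdot (y - cos \<theta> *\<^sub>R x) (y - cos \<theta> *\<^sub>R x) = (1 - (cos \<theta>)\<^sup>2) * (n * n)"
    by (simp add: xy yy nn vdot_commute[of y x] algebra_simps power2_eq_square)
  also have "1 - (cos \<theta>)\<^sup>2 = sin \<theta> * sin \<theta>"
    using sin_cos_squared_add[of \<theta>] unfolding power2_eq_square by linarith
  finally have len: "vdot (y - cos \<theta> *\<^sub>R x) (y - cos \<theta> *\<^sub>R x) = sin \<theta> * sin \<theta> * (n * n)" .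
  show "vdot b b = 1"
    unfolding b vdot_linear(5,6) len using n sin by simp
  show "vdot a b = 0"
    unfolding a_def b by (simp add: xy nn)
  show xa: "x = n *\<^sub>R a" using n by (simp add: a_def)
  have "(n * sin \<theta>) *\<^sub>R b = y - cos \<theta> *\<^sub>R x"
    unfolding b using n sin by simp
  then have yab: "y = (n * cos \<theta>) *\<^sub>R a + (n * sin \<theta>) *\<^sub>R b"
    by (simp add: xa mult.commute)
  then show "?f x = (n * cos \<theta>) *\<^sub>R a + (n * sin \<theta>) *\<^sub>R b"
    by (simp add: y_def)
  have "?f a = (1 / n) *\<^sub>R y"
    by (simp add: a_def y_def)
  then show fa: "?f a = cos \<theta> *\<^sub>R a + sin \<theta> *\<^sub>R b"
    using n by (simp add: yab scaleR_add_right)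
  have "?f (y - cos \<theta> *\<^sub>R x) = cos \<theta> *\<^sub>R y - x"
    unfolding coxeter_linear fy y_def[symmetric] mult_2 scaleR_add_left by simp
  then have "?f b = (1 / (n * sin \<theta>)) *\<^sub>R (cos \<theta> *\<^sub>R y - x)"
    unfolding b coxeter_linear(3) by simp
  also have "cos \<theta> *\<^sub>R y - x = (n * sin \<theta>) *\<^sub>R ((- sin \<theta>) *\<^sub>R a + cos \<theta> *\<^sub>R b)"
  proof -
    have "cos \<theta> *\<^sub>R y - x = (n * (cos \<theta> * cos \<theta> - 1)) *\<^sub>R a + (n * sin \<theta> * cos \<theta>) *\<^sub>R b"
      unfolding yab by (subst xa) (simp add: algebra_simps)
    also have "cos \<theta> * cos \<theta> - 1 = - (sin \<theta> * sin \<theta>)"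
      using sin_cos_squared_add[of \<theta>] unfolding power2_eq_square by linarith
    finally show ?thesis by (simp add: algebra_simps)
  qed
  finally show "?f b = (- sin \<theta>) *\<^sub>R a + cos \<theta> *\<^sub>R b"
    using n sin by simp
qed

lemma unit_bivector_frame:
  assumes "a \<in> vectors" "b \<in> vectors" "vdot a a = 1" "vdot b b = 1" "vdot a b = 0"
    and "0 < r" "0 < t"
  shows "unit_bivector (r *\<^sub>R a) (s *\<^sub>R a + t *\<^sub>R b) = a * b"
proof -
  have ba: "b * a = - (a * b)"
    by (rule orthogonal_anticommute) (use assms in auto)
  have out: "outer (r *\<^sub>R a) (s *\<^sub>R a + t *\<^sub>R b) = (r * t) *\<^sub>R (a * b)"
    by (simp add: outer_def algebra_simps ba flip: scaleR_add_left)
  have gram: "vdot (r *\<^sub>R a) (r *\<^sub>R a) * vdot (s *\<^sub>R a + t *\<^sub>R b) (s *\<^sub>R a + t *\<^sub>R b)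
      - (vdot (r *\<^sub>R a) (s *\<^sub>R a + t *\<^sub>R b))\<^sup>2 = (r * t)\<^sup>2"
    using assms(3-5) by (simp add: vdot_commute[of b a] power2_eq_square algebra_simps)
  have norm: "sqrt ((r * t)\<^sup>2) = r * t" "inverse (r * t) * (r * t) = 1"
    using assms(6,7) by (simp_all del: inverse_mult_distrib)
  show ?thesis
    unfolding unit_bivector_def out gram scaleR_scaleR norm by simp
qed

lemma span_pair_triangular:
  fixes a b :: "'a :: real_vector"
  assumes "r \<noteq> 0" "t \<noteq> 0"
  shows "span {r *\<^sub>R a, s *\<^sub>R a + t *\<^sub>R b} = span {a, b}"
proof
  let ?S = "span {r *\<^sub>R a, s *\<^sub>R a + t *\<^sub>R b}"
  show "?S \<subseteq> span {a, b}"
    by (rule span_minimal) (auto intro: span_add span_scale span_base subspace_span)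
  have "(1 / r) *\<^sub>R (r *\<^sub>R a) \<in> ?S"
    by (rule span_scale) (simp add: span_base)
  with assms have a: "a \<in> ?S" by simp
  have "(1 / t) *\<^sub>R ((s *\<^sub>R a + t *\<^sub>R b) - s *\<^sub>R a) \<in> ?S"
    by (intro span_scale span_diff a) (simp add: span_base)
  with assms have "b \<in> ?S" by simp
  with a show "span {a, b} \<subseteq> ?S"
    by (intro span_minimal) (auto simp: subspace_span)
qed

lemma vec8_cong:
  "x1 = y1 \<Longrightarrow> x2 = y2 \<Longrightarrow> x3 = y3 \<Longrightarrow> x4 = y4 \<Longrightarrow> x5 = y5 \<Longrightarrow> x6 = y6 \<Longrightarrow> x7 = y7 \<Longrightarrow> x8 = y8 \<Longrightarrow>
    vec8 x1 x2 x3 x4 x5 x6 x7 x8 = vec8 y1 y2 y3 y4 y5 y6 y7 y8"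
  by simp

text \<open>
  The minimal polynomial of \<open>2 cos (2 \<pi> / 30)\<close>.
\<close>

definition min_poly :: "real \<Rightarrow> real" where
  "min_poly c = c ^ 4 + c ^ 3 - 4 * c ^ 2 - 4 * c + 1"

text \<open>
  A vector of the rotation space of trace \<open>c\<close> that is orthogonal to the roots \<open>\<alpha>2\<close>, \<open>\<alpha>4\<close>, \<open>\<alpha>6\<close>,
  \<open>\<alpha>8\<close>, hence fixed by the first four reflections; this determines it up to a factor, and \<open>e_3\<close> is given
  the coefficient \<open>1\<close>.
\<close>

definition plane_vec :: "real \<Rightarrow> cl8" where
  "plane_vec c = vec8 0 0 1 1 (c ^ 3 - 3 * c) (c ^ 3 - 3 * c) (c ^ 2 - 2) (c ^ 2 + 2 * c)"

lemma coxeter_plane_vec: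
  "coxeter_element (plane_vec c) =
     vec8 (c ^ 3 / 2 - 2 * c) (1 + 2 * c - c ^ 3 / 2) (2 * c - c ^ 3 / 2) (c ^ 3 / 2 - c)
       (1 + 2 * c - c ^ 3 / 2) (c ^ 2 - 2 + 2 * c - c ^ 3 / 2) (c ^ 3 / 2 - c) (c ^ 2 + c ^ 3 / 2)"
  unfolding plane_vec_def coxeter_vec8 Let_def
  by (rule vec8_cong; simp add: field_simps)

lemma plane_vec_nonzero: "plane_vec c \<noteq> 0"
proof
  assume "plane_vec c = 0"
  then have "coef (plane_vec c) {3} = coef 0 {3}" by simp
  then show False by (simp add: plane_vec_def)
qed

lemma plane_vec_rotation_space:
  assumes "min_poly c = 0"
  shows "plane_vec c \<in> rotation_space c"
proof -
  have c4: "c * c ^ 3 = - (c ^ 3) + 4 * c ^ 2 + 4 * c - 1"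
    using assms by (simp add: min_poly_def power4_eq_xxxx power3_eq_cube algebra_simps)
  have "coxeter_element (coxeter_element (plane_vec c)) + plane_vec c =
      c *\<^sub>R coxeter_element (plane_vec c)"
    unfolding coxeter_plane_vec unfolding plane_vec_def coxeter_vec8 Let_def vec8_linear
    by (rule vec8_cong; insert c4; simp only: power2_eq_square power3_eq_cube; simp add: algebra_simps add_divide_distrib diff_divide_distrib)
  then show ?thesis
    by (simp add: rotation_space_def plane_vec_def)
qed

definition turn :: "nat \<Rightarrow> real" where
  "turn k = 2 * pi * real k / 30"

text \<open>
  The trace of a plane rotation by \<open>turn k\<close>.
\<close>

definition trace :: "nat \<Rightarrow> real" where
  "trace k = 2 * cos (turn k)"

text \<open>
  The two hypotheses say that \<open>turn m\<close> is \<open>\<pi>\<close> minus twice \<open>turn k\<close>, up to sign, so this is the doubling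
  formula.
\<close>

lemma trace_step:
  assumes "m + 2 * k = 15 \<or> m + 15 = 2 * k"
  shows "trace m = 2 - (trace k)\<^sup>2"
proof -
  have "real m = 15 - 2 * real k \<or> real m = 2 * real k - 15"
    using assms by linarith
  then have "turn m = pi - 2 * turn k \<or> turn m = 2 * turn k - pi"
    unfolding turn_def by (elim disjE; simp only:; simp add: field_simps)
  then have "cos (turn m) = - cos (2 * turn k)" by auto
  then have "cos (turn m) = 1 - 2 * (cos (turn k))\<^sup>2"
    unfolding cos_double_cos by simp
  then show ?thesis
    by (simp add: trace_def power_mult_distrib)
qed

lemma trace_steps:
  "trace 13 = 2 - (trace 1)\<^sup>2" "trace 11 = 2 - (trace 13)\<^sup>2" "trace 7 = 2 - (trace 11)\<^sup>2"
  by (rule trace_step; simp)+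

lemma min_poly_step: "min_poly (2 - c\<^sup>2) = min_poly c * min_poly (- c)"
  unfolding min_poly_def
  by (simp add: power2_eq_square power3_eq_cube power4_eq_xxxx algebra_simps)

lemma trace_1_gt: "1 < trace 1"
proof -
  have "cos (pi / 3) < cos (pi / 15)"
    by (rule cos_monotone_0_pi) simp_all
  then show ?thesis by (simp add: trace_def turn_def cos_60)
qed

text \<open>
  For \<open>t = \<pi> / 15\<close> the value \<open>cos (5 t) = 1 / 2\<close> is a quintic equation for \<open>2 cos t\<close>, which splits off the
  factor \<open>2 cos t - 1\<close>.
\<close>

lemma min_poly_trace_1: "min_poly (trace 1) = 0"
proof -
  define t where "t = pi / 15"
  have t: "trace 1 = 2 * cos t" by (simp add: trace_def turn_def t_def)
  have "cos (5 * t) = 1 / 2"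
    using cos_60 by (simp add: t_def)
  moreover have "cos (5 * t) = cos (3 * t) * cos (2 * t) - sin (3 * t) * sin (2 * t)"
    by (simp flip: cos_add distrib_right)
  moreover have "cos t = cos (3 * t) * cos (2 * t) + sin (3 * t) * sin (2 * t)"
    by (simp flip: cos_diff left_diff_distrib)
  ultimately have "1 / 2 + cos t = 2 * cos (3 * t) * cos (2 * t)" by linarith
  then have "(trace 1 - 1) * min_poly (trace 1) = 0"
  proof -
    have "(2 * y - 1) * min_poly (2 * y) =
        2 * (2 * (4 * y ^ 3 - 3 * y) * (2 * y\<^sup>2 - 1) - (1 / 2 + y))" for y
      by (simp add: min_poly_def power2_eq_square power3_eq_cube power4_eq_xxxx algebra_simps)
    with \<open>1 / 2 + cos t = _\<close> show ?thesis
      unfolding t cos_treble_cos cos_double_cos by simp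
  qed
  then show ?thesis using trace_1_gt by simp
qed

lemma min_poly_trace:
  assumes "k \<in> {1, 7, 11, 13}"
  shows "min_poly (trace k) = 0"
  using assms min_poly_trace_1 by (auto simp: trace_steps min_poly_step)

text \<open>
  The first bound compares \<open>c\<close> with a decimal \<open>m\<close> through
  \<open>min_poly c - min_poly m = (c - m) q\<close> with \<open>q \<ge> 1\<close>; the doubling steps propagate it, each losing
  at most a factor of about \<open>4\<close> in accuracy.
\<close>

lemma trace_bounds:
  "\<bar>trace 1 - 1.95629520146761\<bar> < 1 / 10 ^ 13" "\<bar>trace 13 - (- 1.8270909152852)\<bar> < 1 / 10 ^ 12"
  "\<bar>trace 11 - (- 1.33826121271772)\<bar> < 1 / 10 ^ 11" "\<bar>trace 7 - 0.20905692653531\<bar> < 1 / 10 ^ 10"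
proof -
  define x where "x = trace 1"
  define m :: real where "m = 1.95629520146761"
  have x: "1 < x" "min_poly x = 0"
    using trace_1_gt min_poly_trace_1 by (simp_all add: x_def)
  define q where "q = x ^ 3 + (1 + m) * x ^ 2 + (m ^ 2 + m - 4) * x + (m ^ 3 + m ^ 2 - 4 * m - 4)"
  have "min_poly x - min_poly m = (x - m) * q"
    unfolding min_poly_def q_def
    by (simp add: power2_eq_square power3_eq_cube power4_eq_xxxx algebra_simps)
  then have 1: "\<bar>min_poly m\<bar> = \<bar>x - m\<bar> * \<bar>q\<bar>"
    using x(2) by (simp flip: abs_mult)
  have "1 \<le> x ^ 3" "1 \<le> x ^ 2" using x(1) by (simp_all add: one_le_power)
  then have "1 \<le> q"
  proof -
    have "1 * x\<^sup>2 \<le> (1 + m) * x\<^sup>2" "1 * x \<le> (m\<^sup>2 + m - 4) * x"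
      using x(1) by (intro mult_right_mono; simp add: m_def power_divide)+
    moreover have "- 1 \<le> m ^ 3 + m\<^sup>2 - 4 * m - 4"
      by (simp add: m_def power_divide)
    ultimately show ?thesis
      using \<open>1 \<le> x ^ 3\<close> \<open>1 \<le> x\<^sup>2\<close> x(1) unfolding q_def by linarith
  qed
  then have "\<bar>x - m\<bar> * 1 \<le> \<bar>x - m\<bar> * \<bar>q\<bar>"
    by (intro mult_left_mono) auto
  also have "\<dots> < 1 / 10 ^ 13"
    unfolding 1[symmetric] by (simp add: m_def min_poly_def power_divide)
  finally show b1: "\<bar>trace 1 - 1.95629520146761\<bar> < 1 / 10 ^ 13" by (simp add: x_def m_def)
  have step: "\<bar>2 - y\<^sup>2 - n\<bar> < d"
    if "\<bar>y - m\<bar> < e" "e \<le> 1 / 100" "\<bar>m\<bar> \<le> 199 / 100"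
      "4 * e + \<bar>2 - m\<^sup>2 - n\<bar> \<le> d" for y m n e d :: real
  proof -
    have "\<bar>y + m\<bar> < 4" using that by linarith
    then have "\<bar>y - m\<bar> * \<bar>y + m\<bar> \<le> \<bar>y - m\<bar> * 4"
      by (intro mult_left_mono) auto
    then have "\<bar>y\<^sup>2 - m\<^sup>2\<bar> < 4 * e"
      using that by (simp add: square_diff_square_factored power2_eq_square abs_mult mult.commute)
    then show ?thesis using that(4) by linarith
  qed
  show b13: "\<bar>trace 13 - (- 1.8270909152852)\<bar> < 1 / 10 ^ 12"
    unfolding trace_steps(1)
    by (rule step[OF b1]) (simp_all add: power2_eq_square)
  show b11: "\<bar>trace 11 - (- 1.33826121271772)\<bar> < 1 / 10 ^ 11"
    unfolding trace_steps(2)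
    by (rule step[OF b13]) (simp_all add: power2_eq_square)
  show "\<bar>trace 7 - 0.20905692653531\<bar> < 1 / 10 ^ 10"
    unfolding trace_steps(3)
    by (rule step[OF b11]) (simp_all add: power2_eq_square)
qed

lemma inj_trace: "inj_on trace {1, 7, 11, 13}"
proof -
  have "1 < trace 1" "trace 13 < - 1.5" "- 1.5 < trace 11" "trace 11 < 0" "0 < trace 7" "trace 7 < 1"
    using trace_bounds unfolding abs_less_iff by simp_all
  then show ?thesis by (auto simp: inj_on_def)
qed

lemma sin_turn_pos: "k \<in> {1, 7, 11, 13} \<Longrightarrow> 0 < sin (turn k)"
  unfolding turn_def by (rule sin_gt_zero) auto

definition axis1 :: "nat \<Rightarrow> cl8" where
  "axis1 k = (1 / sqrt (vdot (plane_vec (trace k)) (plane_vec (trace k)))) *\<^sub>R plane_vec (trace k)"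

definition axis2 :: "nat \<Rightarrow> cl8" where
  "axis2 k = (1 / (sqrt (vdot (plane_vec (trace k)) (plane_vec (trace k))) * sin (turn k))) *\<^sub>R
     (coxeter_element (plane_vec (trace k)) - cos (turn k) *\<^sub>R plane_vec (trace k))"

context
  fixes k :: nat
  assumes k: "k \<in> {1, 7, 11, 13}"
begin

lemma plane_vec_trace: "plane_vec (trace k) \<in> rotation_space (2 * cos (turn k))"
  using plane_vec_rotation_space[OF min_poly_trace[OF k]] by (simp add: trace_def)

lemmas frame = rotation_frame[OF plane_vec_trace plane_vec_nonzero sin_turn_pos[OF k],
    folded axis1_def axis2_def]

lemma axis_space: "axis1 k \<in> rotation_space (trace k)" "axis2 k \<in> rotation_space (trace k)"
  using frame(2,3) by (simp_all add: trace_def)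

lemma axis_vectors: "axis1 k \<in> vectors" "axis2 k \<in> vectors"
  using axis_space by (auto intro: rotation_space_vectors)

lemmas axis_unit = frame(4-6)

lemmas coxeter_axis = frame(9,10)

lemma axis_pair:
  assumes "0 < r" "0 < p"
  defines "x \<equiv> plane_vec (trace k)"
  shows "unit_bivector (r *\<^sub>R x) (p *\<^sub>R (x + coxeter_element x)) = axis1 k * axis2 k"
    and "span {r *\<^sub>R x, p *\<^sub>R (x + coxeter_element x)} = span {axis1 k, axis2 k}"
proof -
  define n where "n = sqrt (vdot x x)"
  have n: "0 < n" using frame(1) by (simp add: n_def x_def)
  have x: "x = n *\<^sub>R axis1 k"
    "coxeter_element x = (n * cos (turn k)) *\<^sub>R axis1 k + (n * sin (turn k)) *\<^sub>R axis2 k"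
    using frame(7,8) by (simp_all add: n_def x_def)
  have rx: "r *\<^sub>R x = (r * n) *\<^sub>R axis1 k"
    by (subst x(1)) simp
  have px: "p *\<^sub>R (x + coxeter_element x) =
      (p * n * (1 + cos (turn k))) *\<^sub>R axis1 k + (p * n * sin (turn k)) *\<^sub>R axis2 k"
    unfolding x(2) by (subst x(1)) (simp add: algebra_simps)
  have pos: "0 < r * n" "0 < p * n * sin (turn k)"
    using assms(1,2) n sin_turn_pos[OF k] by simp_all
  show "unit_bivector (r *\<^sub>R x) (p *\<^sub>R (x + coxeter_element x)) = axis1 k * axis2 k"
    unfolding rx px by (rule unit_bivector_frame[OF axis_vectors axis_unit pos])
  show "span {r *\<^sub>R x, p *\<^sub>R (x + coxeter_element x)} = span {axis1 k, axis2 k}"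
    unfolding rx px by (intro span_pair_triangular pos[THEN less_imp_neq, THEN not_sym])
qed

lemma rotates_axis_plane: "rotates_plane coxeter_element (span {axis1 k, axis2 k}) (turn k)"
  unfolding rotates_plane_def
proof (intro bexI conjI allI)
  fix s t
  show "coxeter_element (s *\<^sub>R axis1 k + t *\<^sub>R axis2 k) =
      (s * cos (turn k) - t * sin (turn k)) *\<^sub>R axis1 k +
      (s * sin (turn k) + t * cos (turn k)) *\<^sub>R axis2 k"
    unfolding coxeter_linear coxeter_axis by (simp add: algebra_simps)
qed (use axis_unit axis_vectors in simp_all)

end

lemma axis_orthonormal:
  assumes "j \<in> {1, 7, 11, 13}" "k \<in> {1, 7, 11, 13}"
  shows "vdot (axis1 j) (axis1 k) = (if j = k then 1 else 0)"
    and "vdot (axis2 j) (axis2 k) = (if j = k then 1 else 0)"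
    and "vdot (axis1 j) (axis2 k) = 0" and "vdot (axis2 j) (axis1 k) = 0"
proof -
  have "trace j \<noteq> trace k" if "j \<noteq> k"
    using inj_on_contraD[OF inj_trace that assms] .
  note orth = rotation_space_orthogonal[OF _ _ this]
  note space = axis_space[OF assms(1)] axis_space[OF assms(2)]
  show "vdot (axis1 j) (axis1 k) = (if j = k then 1 else 0)"
    "vdot (axis2 j) (axis2 k) = (if j = k then 1 else 0)"
    "vdot (axis1 j) (axis2 k) = 0" "vdot (axis2 j) (axis1 k) = 0"
    using orth space axis_unit[OF assms(1)] vdot_commute[of "axis2 j" "axis1 j"]
    by (cases "j = k"; simp)+
qed

definition axes :: "cl8 set" where
  "axes = axis1 ` {1, 7, 11, 13} \<union> axis2 ` {1, 7, 11, 13}"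

lemma vectors_span_axes: "vectors = span axes"
proof -
  let ?K = "{1, 7, 11, 13} :: nat set"
  have on: "vdot v w = (if v = w then 1 else 0)" if "v \<in> axes" "w \<in> axes" for v w
  proof -
    have "v = w \<or> vdot v w = 0"
      using that unfolding axes_def by (elim UnE imageE; metis axis_orthonormal)
    moreover have "vdot v v = 1"
      using that axis_unit unfolding axes_def by (elim UnE imageE; metis)
    ultimately show ?thesis by auto
  qed
  have "inj_on axis1 ?K" "inj_on axis2 ?K"
    by (rule inj_onI; metis axis_orthonormal(1,2) zero_neq_one)+
  then have "card (axis1 ` ?K) = 4" "card (axis2 ` ?K) = 4"
    by (simp_all add: card_image del: image_insert)
  moreover have "axis1 j \<noteq> axis2 k" if "j \<in> ?K" "k \<in> ?K" for j k
    using axis_orthonormal(3)[OF that] axis_orthonormal(2)[OF that(2,2)] by auto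
  then have "axis1 ` ?K \<inter> axis2 ` ?K = {}"
    by blast
  ultimately have "card axes = 8"
    unfolding axes_def by (subst card_Un_disjoint) simp_all
  moreover have "card (evec ` {1..8}) \<le> 8"
    using card_image_le[of "{1..8::nat}" evec] by simp
  moreover have "axes \<subseteq> vectors"
    using axis_vectors unfolding axes_def by blast
  moreover have "finite axes" by (simp add: axes_def)
  ultimately show ?thesis
    unfolding vectors_def by (intro orthonormal_spans on) auto
qed

text \<open>
  The component of \<open>x\<close> orthogonal to both axes lies in the same rotation space, so it is orthogonal to all 8
  axes and vanishes.
\<close>

lemma rotation_space_axis_plane:
  assumes k: "k \<in> {1, 7, 11, 13}" and x: "x \<in> rotation_space (trace k)"
  shows "x \<in> span {axis1 k, axis2 k}"
proof -
  define p where "p = vdot x (axis1 k) *\<^sub>R axis1 k + vdot x (axis2 k) *\<^sub>R axis2 k"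
  define y where "y = x - p"
  note sub = subspace_rotation_space[of "trace k"]
  have y: "y \<in> rotation_space (trace k)"
    unfolding y_def p_def
    by (intro subspace_diff[OF sub] subspace_add[OF sub] subspace_scale[OF sub] axis_space[OF k] x)
  have "vdot y (axis1 j) = 0 \<and> vdot y (axis2 j) = 0" if j: "j \<in> {1, 7, 11, 13}" for j
  proof (cases "j = k")
    case True
    then show ?thesis
      using axis_orthonormal[OF k k] by (simp add: y_def p_def)
  next
    case False
    then have "trace k \<noteq> trace j"
      using inj_on_contraD[OF inj_trace _ k j] by simp
    then show ?thesis
      using rotation_space_orthogonal[OF y] axis_space[OF j] by blast
  qed
  then have "axes \<subseteq> {z. vdot y z = 0}"
    unfolding axes_def by blast
  moreover have "subspace {z. vdot y z = 0}"
    by (rule subspaceI) simp_all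
  ultimately have "span axes \<subseteq> {z. vdot y z = 0}"
    by (rule span_minimal)
  with rotation_space_vectors[OF y] have "vdot y y = 0"
    unfolding vectors_span_axes by blast
  with vdot_pos[OF rotation_space_vectors[OF y]] have "y = 0" by force
  then have "x = p" by (simp add: y_def)
  moreover have "p \<in> span {axis1 k, axis2 k}"
    unfolding p_def by (intro span_add span_scale span_base) simp_all
  ultimately show ?thesis by simp
qed

lemma rotates_plane_unique:
  assumes k: "k \<in> {1, 7, 11, 13}" and "rotates_plane coxeter_element Q (turn k)"
  shows "Q = span {axis1 k, axis2 k}"
proof -
  let ?f = coxeter_element and ?c = "cos (turn k)" and ?s = "sin (turn k)"
  obtain a b where ab: "a \<in> vectors" "b \<in> vectors" "vdot a a = 1" "vdot b b = 1" "vdot a b = 0"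
    and Q: "Q = span {a, b}"
    and rot: "\<And>s t. ?f (s *\<^sub>R a + t *\<^sub>R b) = (s * ?c - t * ?s) *\<^sub>R a + (s * ?s + t * ?c) *\<^sub>R b"
    using assms(2) unfolding rotates_plane_def by blast
  have fa: "?f a = ?c *\<^sub>R a + ?s *\<^sub>R b" and fb: "?f b = (- ?s) *\<^sub>R a + ?c *\<^sub>R b"
    using rot[of 1 0] rot[of 0 1] by simp_all
  have "?s * ?s = 1 - ?c * ?c"
    using sin_cos_squared_add[of "turn k"] unfolding power2_eq_square by linarith
  then have sc: "?c * ?c - ?s * ?s + 1 = 2 * ?c * ?c" by simp
  have double: "(?c * ?s) *\<^sub>R v + (?c * ?s) *\<^sub>R v = (2 * ?c * ?s) *\<^sub>R v" for v :: cl8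
    by (simp flip: scaleR_add_left)
  have "?f (?f a) + a = (?c * ?c - ?s * ?s + 1) *\<^sub>R a + ((?c * ?s) *\<^sub>R b + (?c * ?s) *\<^sub>R b)"
    unfolding fa coxeter_linear unfolding fa fb by (simp add: algebra_simps)
  then have "?f (?f a) + a = (2 * ?c) *\<^sub>R ?f a"
    unfolding sc double fa by (simp add: scaleR_add_right)
  moreover have "?f (?f b) + b = (?c * ?c - ?s * ?s + 1) *\<^sub>R b - ((?c * ?s) *\<^sub>R a + (?c * ?s) *\<^sub>R a)"
    unfolding fb coxeter_linear unfolding fa fb by (simp add: algebra_simps)
  then have "?f (?f b) + b = (2 * ?c) *\<^sub>R ?f b"
    unfolding sc double fb by (simp add: scaleR_diff_right)
  ultimately have "{a, b} \<subseteq> span {axis1 k, axis2 k}"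
    using ab rotation_space_axis_plane[OF k] by (simp add: rotation_space_def trace_def)
  moreover have "a \<noteq> b" using ab by auto
  ultimately show ?thesis
    unfolding Q using ab
    by (intro orthonormal_spans[symmetric]) (auto simp: vdot_commute[of b a] card_insert_if)
qed

lemma orthogonal_axis_planes:
  assumes "j \<in> {1, 7, 11, 13}" "k \<in> {1, 7, 11, 13}" "j \<noteq> k"
  shows "orthogonal_planes (span {axis1 j, axis2 j}) (span {axis1 k, axis2 k})"
proof -
  have "span {axis1 i, axis2 i} \<subseteq> rotation_space (trace i)" if "i \<in> {1, 7, 11, 13}" for i
    using axis_space[OF that] by (intro span_minimal subspace_rotation_space) simp
  with assms inj_on_contraD[OF inj_trace assms(3,1,2)] show ?thesis
    unfolding orthogonal_planes_def by (meson rotation_space_orthogonal subsetD)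
qed

section \<open>Rotors and the factorisation of the versor\<close>

context
  fixes a b :: cl8
  assumes ab: "a \<in> vectors" "b \<in> vectors" "vdot a a = 1" "vdot b b = 1" "vdot a b = 0"
begin

lemma frame_products:
  "a * (a * b) = b" "a * b * a = - b" "b * (a * b) = - a" "a * b * b = a" "a * b * (a * b) = - 1"
proof -
  have sq: "a * a = 1" "b * b = 1"
    using ab by (simp_all add: vector_square)
  have ba: "b * a = - (a * b)"
    using ab by (intro orthogonal_anticommute) auto
  show 1: "a * (a * b) = b" by (simp add: sq flip: mult.assoc)
  show 2: "a * b * b = a" by (simp add: sq mult.assoc)
  show "a * b * a = - b" by (simp add: mult.assoc ba 1)
  show "b * (a * b) = - a" by (simp add: ba 2 flip: mult.assoc)
  show "a * b * (a * b) = - 1"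
    by (simp add: mult.assoc) (simp add: ba sq flip: mult.assoc)
qed

lemma rotor_eq: "exp (\<phi> *\<^sub>R (a * b)) = cos \<phi> *\<^sub>R 1 + sin \<phi> *\<^sub>R (a * b)"
  by (rule exp_unit_bivector[OF frame_products(5)])

lemma rotor_minus_eq: "exp ((- \<phi>) *\<^sub>R (a * b)) = cos \<phi> *\<^sub>R 1 - sin \<phi> *\<^sub>R (a * b)"
  using rotor_eq[of "- \<phi>"] by simp

lemma rotor_inverse: "exp (\<phi> *\<^sub>R (a * b)) * exp ((- \<phi>) *\<^sub>R (a * b)) = 1"
  "exp ((- \<phi>) *\<^sub>R (a * b)) * exp (\<phi> *\<^sub>R (a * b)) = 1"
  using exp_minus_inverse[of "\<phi> *\<^sub>R (a * b)"] exp_minus_inverse[of "- (\<phi> *\<^sub>R (a * b))"]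
  by simp_all

text \<open>
  The bivector \<open>a b\<close> anticommutes with the vectors of its plane and acts on them from the right as the quarter
  turn from \<open>a\<close> to \<open>b\<close>. Moving the left factor across the vector therefore doubles the angle.
\<close>

lemma rotor_rotates:
  "exp ((- \<phi>) *\<^sub>R (a * b)) * (s *\<^sub>R a + t *\<^sub>R b) * exp (\<phi> *\<^sub>R (a * b)) =
     s *\<^sub>R (cos (2 * \<phi>) *\<^sub>R a + sin (2 * \<phi>) *\<^sub>R b) + t *\<^sub>R ((- sin (2 * \<phi>)) *\<^sub>R a + cos (2 * \<phi>) *\<^sub>R b)"
proof -
  let ?B = "a * b"
  have B: "a * ?B = b" "?B * a = - b" "b * ?B = - a" "?B * b = a"
    by (rule frame_products)+
  define v where "v = s *\<^sub>R a + t *\<^sub>R b"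
  define u where "u = s *\<^sub>R b - t *\<^sub>R a"
  have v: "?B * v = - u" "v * ?B = u" "u * ?B = - v"
    by (simp_all add: v_def u_def B distrib_left distrib_right left_diff_distrib)
  have "exp ((- \<phi>) *\<^sub>R ?B) * v * exp (\<phi> *\<^sub>R ?B) =
      (cos \<phi> *\<^sub>R v + sin \<phi> *\<^sub>R u) * exp (\<phi> *\<^sub>R ?B)"
    unfolding rotor_minus_eq by (simp add: left_diff_distrib v)
  also have "\<dots> = (cos \<phi> * cos \<phi> - sin \<phi> * sin \<phi>) *\<^sub>R v + (sin \<phi> * cos \<phi> + sin \<phi> * cos \<phi>) *\<^sub>R u"
    unfolding rotor_eq by (simp add: algebra_simps v flip: scaleR_add_left)
  also have "cos \<phi> * cos \<phi> - sin \<phi> * sin \<phi> = cos (2 * \<phi>)"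
    by (simp add: cos_double power2_eq_square)
  also have "sin \<phi> * cos \<phi> + sin \<phi> * cos \<phi> = sin (2 * \<phi>)"
    by (simp add: sin_double)
  finally show ?thesis
    unfolding v_def u_def by (simp add: algebra_simps)
qed

lemma rotor_commute:
  assumes "x \<in> vectors" "vdot a x = 0" "vdot b x = 0"
  shows "x * exp (\<phi> *\<^sub>R (a * b)) = exp (\<phi> *\<^sub>R (a * b)) * x"
proof -
  have "x * a = - (a * x)" "x * b = - (b * x)"
    using assms ab by (auto intro: orthogonal_anticommute)
  then have "x * (a * b) = a * b * x"
    by (metis (no_types, opaque_lifting) mult.assoc mult_minus_left mult_minus_right minus_minus)
  then show ?thesis
    unfolding rotor_eq by (simp add: distrib_left distrib_right)
qed

lemma reversal_rotor_times:
  "reversal (exp (\<phi> *\<^sub>R (a * b)) * x) = reversal x * exp ((- \<phi>) *\<^sub>R (a * b))"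
proof -
  have ba: "b * a = - (a * b)"
    using ab by (intro orthogonal_anticommute) auto
  have "reversal (a * b * x) = - (reversal x * (a * b))"
    using ab by (simp add: mult.assoc reversal_vector_times ba)
  then show ?thesis
    unfolding rotor_eq rotor_minus_eq by (simp add: distrib_right right_diff_distrib)
qed

text \<open>
  If \<open>a\<close> commutes with \<open>x\<close>, cycling \<open>a\<close> around the product \<open>a b x\<close> replaces \<open>a b\<close> by \<open>b a = - a b\<close>, so the
  bivector part contributes no scalar.
\<close>

lemma scalar_part_rotor_times:
  assumes "a * x = x * a"
  shows "coef (exp (\<phi> *\<^sub>R (a * b)) * x) {} = cos \<phi> * coef x {}"
proof -
  have ba: "b * a = - (a * b)"
    using ab by (intro orthogonal_anticommute) auto
  have "coef (a * b * x) {} = coef (b * x * a) {}"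
    using scalar_part_commute[of a "b * x"] by (simp add: mult.assoc)
  also have "b * x * a = b * a * x"
    by (simp add: mult.assoc assms)
  also have "\<dots> = - (a * b * x)"
    by (simp add: ba)
  finally have "coef (a * b * x) {} = 0" by simp
  then show ?thesis
    unfolding rotor_eq by (simp add: distrib_right)
qed

end

definition rotor :: "nat \<Rightarrow> cl8" where
  "rotor k = exp ((turn k / 2) *\<^sub>R (axis1 k * axis2 k))"

definition rotor_inv :: "nat \<Rightarrow> cl8" where
  "rotor_inv k = exp ((- (turn k / 2)) *\<^sub>R (axis1 k * axis2 k))"

lemma rotor_acts:
  assumes "j \<in> {1, 7, 11, 13}" "k \<in> {1, 7, 11, 13}" and x: "x = s *\<^sub>R axis1 k + t *\<^sub>R axis2 k"
  shows "rotor_inv j * x * rotor j = (if j = k then coxeter_element x else x)"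
proof (cases "j = k")
  case True
  with assms show ?thesis
    by (simp add: rotor_def rotor_inv_def coxeter_axis
        rotor_rotates[OF axis_vectors[OF assms(2)] axis_unit[OF assms(2)]] del: scaleR_minus_left)
next
  case False
  note frame = axis_vectors[OF assms(1)] axis_unit[OF assms(1)]
  have "x * rotor j = rotor j * x"
    unfolding rotor_def x using axis_vectors[OF assms(2)] axis_orthonormal[OF assms(1,2)] False
    by (intro rotor_commute[OF frame]) simp_all
  moreover have "rotor_inv j * rotor j = 1"
    unfolding rotor_def rotor_inv_def by (rule rotor_inverse[OF frame])
  ultimately show ?thesis
    using False by (simp add: mult.assoc) (simp flip: mult.assoc)
qed

lemma rotors_act:
  assumes "set l \<subseteq> {1, 7, 11, 13}" "distinct l" "k \<in> {1, 7, 11, 13}"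
  shows "prod_list (map rotor_inv (rev l)) * (s *\<^sub>R axis1 k + t *\<^sub>R axis2 k) * prod_list (map rotor l) =
    (if k \<in> set l then coxeter_element (s *\<^sub>R axis1 k + t *\<^sub>R axis2 k) else s *\<^sub>R axis1 k + t *\<^sub>R axis2 k)"
  using assms(1,2)
proof (induction l arbitrary: s t)
  case (Cons j l)
  let ?x = "s *\<^sub>R axis1 k + t *\<^sub>R axis2 k"
  have j: "j \<in> {1, 7, 11, 13}" "j \<notin> set l" using Cons.prems by auto
  have IH: "prod_list (map rotor_inv (rev l)) * (s *\<^sub>R axis1 k + t *\<^sub>R axis2 k) * prod_list (map rotor l) =
    (if k \<in> set l then coxeter_element (s *\<^sub>R axis1 k + t *\<^sub>R axis2 k) else s *\<^sub>R axis1 k + t *\<^sub>R axis2 k)" for s t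
    using Cons by simp
  obtain s' t' where st: "coxeter_element ?x = s' *\<^sub>R axis1 k + t' *\<^sub>R axis2 k"
  proof
    show "coxeter_element ?x = (s * cos (turn k) - t * sin (turn k)) *\<^sub>R axis1 k +
        (s * sin (turn k) + t * cos (turn k)) *\<^sub>R axis2 k"
      unfolding coxeter_linear coxeter_axis[OF assms(3)] by (simp add: algebra_simps)
  qed
  have "prod_list (map rotor_inv (rev (j # l))) * ?x * prod_list (map rotor (j # l)) =
      prod_list (map rotor_inv (rev l)) * (rotor_inv j * ?x * rotor j) * prod_list (map rotor l)"
    by (simp add: mult.assoc)
  also have "\<dots> = prod_list (map rotor_inv (rev l)) * (if j = k then coxeter_element ?x else ?x)
      * prod_list (map rotor l)"
    unfolding rotor_acts[OF j(1) assms(3) refl] ..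
  also have "\<dots> = (if k \<in> set (j # l) then coxeter_element ?x else ?x)"
  proof (cases "j = k")
    case True
    then show ?thesis using IH[of s' t'] j(2) by (simp add: st del: coxeter_linear)
  next
    case False
    then show ?thesis using IH[of s t] by simp
  qed
  finally show ?case .
qed simp

lemma rotors_inverse:
  assumes "set l \<subseteq> {1, 7, 11, 13}"
  shows "prod_list (map rotor l) * prod_list (map rotor_inv (rev l)) = 1"
    and "prod_list (map rotor_inv (rev l)) * prod_list (map rotor l) = 1"
proof -
  have cancel: "rotor k * rotor_inv k = 1" "rotor_inv k * rotor k = 1"
    if "k \<in> {1, 7, 11, 13}" for k
    unfolding rotor_def rotor_inv_def
    by (rule rotor_inverse[OF axis_vectors[OF that] axis_unit[OF that]])+
  have "prod_list (map rotor l) * prod_list (map rotor_inv (rev l)) = 1 \<and>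
      prod_list (map rotor_inv (rev l)) * prod_list (map rotor l) = 1"
    using assms
  proof (induction l)
    case (Cons k l)
    let ?P = "prod_list (map rotor l)" and ?Q = "prod_list (map rotor_inv (rev l))"
    have k: "k \<in> {1, 7, 11, 13}" and IH: "?P * ?Q = 1" "?Q * ?P = 1" using Cons by auto
    have "rotor k * ?P * (?Q * rotor_inv k) = rotor k * (?P * ?Q) * rotor_inv k"
      "?Q * rotor_inv k * (rotor k * ?P) = ?Q * (rotor_inv k * rotor k) * ?P"
      by (simp_all only: mult.assoc)
    then show ?case by (simp add: IH cancel[OF k])
  qed simp
  then show "prod_list (map rotor l) * prod_list (map rotor_inv (rev l)) = 1"
    "prod_list (map rotor_inv (rev l)) * prod_list (map rotor l) = 1" by simp_all
qed

lemma reversal_rotors: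
  assumes "set l \<subseteq> {1, 7, 11, 13}"
  shows "reversal (prod_list (map rotor l)) = prod_list (map rotor_inv (rev l))"
  using assms
proof (induction l)
  case (Cons k l)
  then have k: "k \<in> {1, 7, 11, 13}" by simp
  from Cons show ?case
    by (simp add: rotor_def rotor_inv_def reversal_rotor_times[OF axis_vectors[OF k] axis_unit[OF k]]
        del: scaleR_minus_left)
qed simp

lemma scalar_part_rotors:
  assumes "set l \<subseteq> {1, 7, 11, 13}" "distinct l"
  shows "coef (prod_list (map rotor l)) {} = (\<Prod>k\<leftarrow>l. cos (turn k / 2))"
  using assms
proof (induction l)
  case (Cons k l)
  then have k: "k \<in> {1, 7, 11, 13}" and kl: "k \<notin> set l" "set l \<subseteq> {1, 7, 11, 13}" by auto
  have "axis1 k * prod_list (map rotor l) = prod_list (map rotor l) * axis1 k"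
    using kl
  proof (induction l)
    case (Cons j l)
    then have j: "j \<in> {1, 7, 11, 13}" "j \<noteq> k" by auto
    have "axis1 k * rotor j = rotor j * axis1 k"
      unfolding rotor_def using axis_vectors[OF k] axis_orthonormal[OF j(1) k] j(2)
      by (intro rotor_commute[OF axis_vectors[OF j(1)] axis_unit[OF j(1)]]) simp_all
    then have "axis1 k * (rotor j * prod_list (map rotor l)) = rotor j * (axis1 k * prod_list (map rotor l))"
      by (simp flip: mult.assoc)
    with Cons show ?case by (simp add: mult.assoc)
  qed simp
  from scalar_part_rotor_times[OF axis_vectors[OF k] axis_unit[OF k] this] Cons show ?case
    by (simp add: rotor_def[of k])
qed simp

lemma scalar_part_blade_sum:
  assumes "\<forall>(l, c)\<in>set m. sorted_wrt (<) l \<and> set l \<subseteq> {1..8}"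
  shows "coef (blade_sum m) {} = (\<Sum>(l, c)\<leftarrow>m. if l = [] then of_int c else 0)"
  using assms unfolding blade_sum_def by (induction m) (auto simp: coef_eprod)

lemma scalar_part_coxeter_versor: "coef coxeter_versor {} = - 1 / 16"
  unfolding coxeter_versor_terms coef_arith
  by (subst scalar_part_blade_sum) (simp_all add: versor_terms_def)

text \<open>
  With \<open>V\<close> the product of the rotors, \<open>W V'\<close> commutes with all vectors because \<open>W\<close> and \<open>V\<close> conjugate
  vectors in the same way. Hence \<open>W = z V\<close>, reversal gives \<open>z^2 = 1\<close>, and comparing scalar parts shows
  that \<open>z\<close> is negative.
\<close>

lemma versor_factorisation:
  assumes "set l = {1, 7, 11, 13}" "distinct l"
  shows "coxeter_versor = - prod_list (map rotor l)"
proof -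
  let ?W = "coxeter_versor"
  define V where "V = prod_list (map rotor l)"
  define V' where "V' = prod_list (map rotor_inv (rev l))"
  have VV: "V * V' = 1" "V' * V = 1"
    unfolding V_def V'_def using rotors_inverse assms by simp_all
  have WW: "?W * reversal ?W = 1" by (rule coxeter_versor_unit)
  have same: "V' * v * V = coxeter_element v" if "v \<in> vectors" for v
  proof -
    have "subspace {v. V' * v * V = coxeter_element v}"
      by (rule subspaceI) (simp_all add: distrib_left distrib_right coxeter_element_versor[of 0])
    moreover have "V' * (s *\<^sub>R axis1 k + t *\<^sub>R axis2 k) * V =
        coxeter_element (s *\<^sub>R axis1 k + t *\<^sub>R axis2 k)" if "k \<in> {1, 7, 11, 13}" for k s t
      using rotors_act[OF _ assms(2) that, of s t] assms(1) that unfolding V_def V'_def by simp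
    from this[where s = 1 and t = 0] this[where s = 0 and t = 1]
    have "axes \<subseteq> {v. V' * v * V = coxeter_element v}"
      unfolding axes_def by auto
    ultimately show ?thesis
      using that span_minimal unfolding vectors_span_axes by blast
  qed
  have "evec i * (?W * V') = ?W * V' * evec i" if "i \<in> {1..8}" for i
  proof -
    have "evec i * (?W * V') = ?W * (reversal ?W * evec i * ?W) * V'"
      using WW by (simp flip: mult.assoc)
    also have "reversal ?W * evec i * ?W = V' * evec i * V"
      using same[OF evec_in_vectors[OF that]] by (simp add: coxeter_element_versor)
    also have "?W * (V' * evec i * V) * V' = ?W * V' * evec i * (V * V')"
      by (simp only: mult.assoc)
    finally show ?thesis by (simp add: VV)
  qed
  from central_imp_scalar[OF this] obtain z where z: "?W * V' = z *\<^sub>R 1" by blast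
  have "?W = ?W * V' * V" by (simp add: mult.assoc VV)
  then have W: "?W = z *\<^sub>R V" by (simp add: z)
  have rW: "reversal ?W = z *\<^sub>R V'"
    unfolding W V_def V'_def using assms by (simp add: reversal_rotors)
  have "(z * z) *\<^sub>R (1 :: cl8) = (z *\<^sub>R V) * (z *\<^sub>R V')"
    by (simp add: VV)
  also have "\<dots> = 1"
    unfolding W[symmetric] rW[symmetric] by (rule WW)
  finally have "(z * z) *\<^sub>R (1 :: cl8) = 1" .
  then have "coef ((z * z) *\<^sub>R (1 :: cl8)) {} = coef 1 {}" by simp
  then have zz: "z * z = 1" by simp
  have "0 < cos (turn k / 2)" if "k \<in> set l" for k
    using that unfolding assms(1) turn_def by (intro cos_gt_zero_pi) auto
  then have "0 < (\<Prod>k\<leftarrow>l. cos (turn k / 2))"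
    by (induction l) simp_all
  moreover have "z * (\<Prod>k\<leftarrow>l. cos (turn k / 2)) = - 1 / 16"
    using arg_cong[OF W, of "\<lambda>x. coef x {}"] assms
    by (simp add: scalar_part_coxeter_versor V_def scalar_part_rotors)
  ultimately have "\<not> 0 \<le> z"
    using mult_nonneg_nonneg[of z "\<Prod>k\<leftarrow>l. cos (turn k / 2)"] by linarith
  moreover have "z = 1 \<or> z = - 1"
    using zz by (simp add: square_eq_1_iff)
  ultimately have "z = - 1" by auto
  with W show ?thesis by (simp add: V_def)
qed

section \<open>Eigenvalues of the Coxeter matrix\<close>

definition coords :: "cl8 \<Rightarrow> complex vec" where
  "coords v = vec 8 (\<lambda>i. complex_of_real (coef v {Suc i}))"

lemma vector_sum_evec:
  assumes "v \<in> vectors"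
  shows "v = (\<Sum>j = 0..<8. coef v {Suc j} *\<^sub>R evec (Suc j))"
  by (subst vec8_coef[OF assms]) (simp add: vec8_def eval_nat_numeral)

lemma coxeter_matrix_coords:
  assumes "v \<in> vectors"
  shows "coxeter_matrix *\<^sub>v coords v = coords (coxeter_element v)"
proof (rule eq_vecI)
  fix i assume "i < dim_vec (coords (coxeter_element v))"
  then have i: "i < 8" by (simp add: coords_def)
  have sum: "coxeter_element (sum g S) = (\<Sum>j\<in>S. coxeter_element (g j))" for g and S :: "nat set"
    by (induction S rule: infinite_finite_induct) (auto simp: coxeter_element_versor[of 0])
  have "coxeter_element v = (\<Sum>j = 0..<8. coef v {Suc j} *\<^sub>R coxeter_element (evec (Suc j)))"
    by (subst vector_sum_evec[OF assms]) (simp add: sum)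
  then have "coef (coxeter_element v) {Suc i} =
      (\<Sum>j = 0..<8. coef v {Suc j} * coef (coxeter_element (evec (Suc j))) {Suc i})"
    by (simp add: coef_sum)
  with i show "(coxeter_matrix *\<^sub>v coords v) $ i = coords (coxeter_element v) $ i"
    by (simp add: coxeter_matrix_def coords_def scalar_prod_def mult.commute)
qed (simp add: coxeter_matrix_def coords_def)

lemma coxeter_matrix_dim [simp]: "coxeter_matrix \<in> carrier_mat 8 8"
  by (simp add: coxeter_matrix_def)

text \<open>
  The eigenvector is \<open>a - e b\<close>, where \<open>e\<close> is one of the two square roots of \<open>- 1\<close>; the choice of \<open>e\<close>
  distinguishes the exponents \<open>k\<close> and \<open>30 - k\<close>.
\<close>

lemma eigenvalue_turn:
  assumes k: "k \<in> {1, 7, 11, 13}" and e: "e * e = - 1"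
  shows "eigenvalue coxeter_matrix (complex_of_real (cos (turn k)) + e * complex_of_real (sin (turn k)))"
proof -
  let ?a = "coords (axis1 k)" and ?b = "coords (axis2 k)"
  let ?c = "complex_of_real (cos (turn k))" and ?s = "complex_of_real (sin (turn k))"
  let ?u = "?a + (- e) \<cdot>\<^sub>v ?b"
  have dim [simp]: "?a \<in> carrier_vec 8" "?b \<in> carrier_vec 8"
    by (simp_all add: coords_def)
  have "coxeter_matrix *\<^sub>v ?u = coxeter_matrix *\<^sub>v ?a + (- e) \<cdot>\<^sub>v (coxeter_matrix *\<^sub>v ?b)"
    by (simp add: mult_add_distrib_mat_vec[of _ 8 8] mult_mat_vec[of _ 8 8])
  also have "\<dots> = coords (coxeter_element (axis1 k)) + (- e) \<cdot>\<^sub>v coords (coxeter_element (axis2 k))"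
    by (simp add: coxeter_matrix_coords axis_vectors[OF k])
  also have "\<dots> = (?c + e * ?s) \<cdot>\<^sub>v ?u"
  proof (rule eq_vecI)
    fix i assume "i < dim_vec ((?c + e * ?s) \<cdot>\<^sub>v ?u)"
    then have i: "i < 8" by (simp add: coords_def)
    have "?c * x + ?s * y + - e * (- ?s * x + ?c * y) = (?c + e * ?s) * (x + - e * y)" for x y
    proof -
      have ee: "e * (e * z) = - z" for z
        by (simp add: e flip: mult.assoc)
      show ?thesis by (simp add: algebra_simps e ee)
    qed
    with i show "(coords (coxeter_element (axis1 k)) + (- e) \<cdot>\<^sub>v coords (coxeter_element (axis2 k))) $ i =
        ((?c + e * ?s) \<cdot>\<^sub>v ?u) $ i"
      by (simp add: coords_def coxeter_axis[OF k])
  qed (simp add: coords_def)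
  finally have eq: "coxeter_matrix *\<^sub>v ?u = (?c + e * ?s) \<cdot>\<^sub>v ?u" .
  have "?u \<noteq> 0\<^sub>v 8"
  proof
    assume u: "?u = 0\<^sub>v 8"
    have "Re e * Re e - Im e * Im e = - 1" "Im e = 0 \<or> Re e = 0"
      using e by (auto simp: complex_eq_iff)
    moreover have "Re e * Re e \<noteq> - 1"
      using zero_le_square[of "Re e"] by linarith
    ultimately have "Re e = 0" by auto
    have "coef (axis1 k) {Suc i} = 0" if "i < 8" for i
    proof -
      have "(?a + (- e) \<cdot>\<^sub>v ?b) $ i = 0"
        unfolding u using that by simp
      then have "Re (complex_of_real (coef (axis1 k) {Suc i}) - e * complex_of_real (coef (axis2 k) {Suc i})) = 0"
        using that by (simp add: coords_def)
      with \<open>Re e = 0\<close> show ?thesis by simp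
    qed
    then have "axis1 k = 0"
      by (subst vector_sum_evec[OF axis_vectors(1)[OF k]]) simp
    with axis_unit(1)[OF k] show False by simp
  qed
  with eq show ?thesis
    unfolding eigenvalue_def eigenvector_def by (intro exI[of _ ?u]) (simp add: coxeter_matrix_def coords_def)
qed

lemma exp_turn: "exp (2 * of_real pi * \<i> * of_nat m / 30) = cis (turn m)"
  by (simp add: turn_def cis_conv_exp mult_ac)

lemma inj_cis_turn: "inj_on (\<lambda>m. cis (turn m)) {..<30}"
  using bij_betw_roots_unity[of 30] by (simp add: bij_betw_def turn_def)

lemma eigenvalue_cis_turn:
  assumes "m \<in> {1, 7, 11, 13, 17, 19, 23, 29}"
  shows "eigenvalue coxeter_matrix (cis (turn m))"
proof -
  have pos: "eigenvalue coxeter_matrix (cis (turn k))" if "k \<in> {1, 7, 11, 13}" for k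
    using eigenvalue_turn[OF that, of \<i>] by (simp add: cis.code Complex_eq mult.commute)
  have neg: "eigenvalue coxeter_matrix (cis (turn (30 - k)))" if "k \<in> {1, 7, 11, 13}" for k
  proof -
    have "turn (30 - k) = 2 * pi - turn k"
      using that by (auto simp: turn_def field_simps)
    then have "cis (turn (30 - k)) = complex_of_real (cos (turn k)) + - \<i> * complex_of_real (sin (turn k))"
      by (simp add: complex_eq_iff cos_diff sin_diff)
    with eigenvalue_turn[OF that, of "- \<i>"] show ?thesis by simp
  qed
  show ?thesis
    using assms pos[of 1] pos[of 7] pos[of 11] pos[of 13] neg[of 1] neg[of 7] neg[of 11] neg[of 13]
    by auto
qed

lemma eigenvalues_coxeter_matrix:
  "{z. eigenvalue coxeter_matrix z} = (\<lambda>m. cis (turn m)) ` {1, 7, 11, 13, 17, 19, 23, 29}"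
proof -
  let ?p = "char_poly coxeter_matrix" and ?K = "{1, 7, 11, 13, 17, 19, 23, 29} :: nat set"
  have "?K \<subseteq> {..<30}" by simp
  then have "card ((\<lambda>m. cis (turn m)) ` ?K) = card ?K"
    by (intro card_image inj_on_subset[OF inj_cis_turn])
  then have card: "card ((\<lambda>m. cis (turn m)) ` ?K) = 8" by simp
  have roots: "{z. eigenvalue coxeter_matrix z} = {z. poly ?p z = 0}"
    by (simp add: eigenvalue_root_char_poly[OF coxeter_matrix_dim])
  have deg: "degree ?p = 8"
    using degree_monic_char_poly[OF coxeter_matrix_dim] by simp
  then have p: "?p \<noteq> 0" by auto
  show ?thesis
  proof (rule card_seteq[symmetric])
    show "finite {z. eigenvalue coxeter_matrix z}"
      unfolding roots by (rule poly_roots_finite[OF p])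
    show "(\<lambda>m. cis (turn m)) ` ?K \<subseteq> {z. eigenvalue coxeter_matrix z}"
      using eigenvalue_cis_turn by blast
    show "card {z. eigenvalue coxeter_matrix z} \<le> card ((\<lambda>m. cis (turn m)) ` ?K)"
      unfolding roots card using card_poly_roots_bound[OF p] deg by simp
  qed
qed

lemma exponents_eq: "exponents = {1, 7, 11, 13, 17, 19, 23, 29}"
proof -
  let ?K = "{1, 7, 11, 13, 17, 19, 23, 29} :: nat set"
  have sub: "?K \<subseteq> {..<30}" by simp
  have "eigenvalue coxeter_matrix (cis (turn m)) \<longleftrightarrow> m \<in> ?K" if "m < 30" for m
    using inj_on_image_mem_iff[OF inj_cis_turn _ sub, of m] that
      eigenvalues_coxeter_matrix by auto
  then have "exponents = {m \<in> ?K. 0 < m \<and> m < 30}"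
    unfolding exponents_def exp_turn by blast
  also have "\<dots> = ?K" by auto
  finally show ?thesis .
qed

section \<open>The rounded coefficients\<close>

lemma rounds_to_near:
  assumes "d * 10 ^ k \<in> \<int>" "d - 1 / (2 * 10 ^ k) < x" "x < d + 1 / (2 * 10 ^ k)"
  shows "rounds_to x d k"
proof -
  obtain n where n: "d * 10 ^ k = of_int n"
    using assms(1) by (auto elim: Ints_cases)
  have "(d - 1 / (2 * 10 ^ k)) * 10 ^ k < x * 10 ^ k" "x * 10 ^ k < (d + 1 / (2 * 10 ^ k)) * 10 ^ k"
    using assms(2,3) by (intro mult_strict_right_mono; simp)+
  then have "of_int n - 1 / 2 < x * 10 ^ k" "x * 10 ^ k < of_int n + 1 / 2"
    by (simp_all add: left_diff_distrib distrib_right n)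
  then have "\<bar>x * 10 ^ k - of_int n\<bar> < 1 / 2" by linarith
  then have "round (x * 10 ^ k) = n"
    by (rule round_unique')
  then show ?thesis
    by (simp add: rounds_to_def flip: n)
qed

definition entry_rounds_to :: "real \<Rightarrow> (real \<times> nat) option \<Rightarrow> bool" where
  "entry_rounds_to x e \<longleftrightarrow> (case e of None \<Rightarrow> x = 0 | Some (d, k) \<Rightarrow> rounds_to x d k)"

lemma entry_rounds_to_simps [simp]:
  "entry_rounds_to x None \<longleftrightarrow> x = 0"
  "entry_rounds_to x (Some (d, k)) \<longleftrightarrow> rounds_to x d k"
  by (simp_all add: entry_rounds_to_def)

lemma vector_rounds_to_vec8:
  assumes "entry_rounds_to x1 (map_of table 1)" "entry_rounds_to x2 (map_of table 2)"
    "entry_rounds_to x3 (map_of table 3)" "entry_rounds_to x4 (map_of table 4)"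
    "entry_rounds_to x5 (map_of table 5)" "entry_rounds_to x6 (map_of table 6)"
    "entry_rounds_to x7 (map_of table 7)" "entry_rounds_to x8 (map_of table 8)"
  shows "vector_rounds_to (vec8 x1 x2 x3 x4 x5 x6 x7 x8) table"
proof -
  have "vector_rounds_to (vec8 x1 x2 x3 x4 x5 x6 x7 x8) table \<longleftrightarrow>
      (\<forall>i\<in>{1..8}. entry_rounds_to (coef (vec8 x1 x2 x3 x4 x5 x6 x7 x8) {i}) (map_of table i))"
    by (simp add: vector_rounds_to_def entry_rounds_to_def)
  with assms show ?thesis
    by (simp add: one_to_eight)
qed

lemma power_bounds:
  fixes c m e :: real
  assumes "\<bar>c - m\<bar> < e" "e \<le> 1 / 100" "\<bar>m\<bar> \<le> 199 / 100"
  shows "\<bar>c\<^sup>2 - m\<^sup>2\<bar> < 4 * e" "\<bar>c ^ 3 - m ^ 3\<bar> < 12 * e"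
proof -
  have c: "\<bar>c\<bar> \<le> 2" and m: "\<bar>m\<bar> \<le> 2" using assms by linarith+
  have "\<bar>c + m\<bar> \<le> 4" using c assms(3) by linarith
  then have "\<bar>c - m\<bar> * \<bar>c + m\<bar> \<le> \<bar>c - m\<bar> * 4"
    by (rule mult_left_mono) simp
  moreover have "c\<^sup>2 - m\<^sup>2 = (c - m) * (c + m)"
    by (simp add: power2_eq_square algebra_simps)
  ultimately show "\<bar>c\<^sup>2 - m\<^sup>2\<bar> < 4 * e"
    using assms(1) by (simp add: abs_mult)
  have prod: "\<bar>x * y\<bar> \<le> 4" if "\<bar>x\<bar> \<le> 2" "\<bar>y\<bar> \<le> 2" for x y :: real
    using mult_mono[OF that] by (simp add: abs_mult)
  have "\<bar>c * c\<bar> \<le> 4" "\<bar>c * m\<bar> \<le> 4" "\<bar>m * m\<bar> \<le> 4"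
    by (intro prod c m)+
  then have "\<bar>c * c + c * m + m * m\<bar> \<le> 12" by linarith
  then have "\<bar>c - m\<bar> * \<bar>c * c + c * m + m * m\<bar> \<le> \<bar>c - m\<bar> * 12"
    by (rule mult_left_mono) simp
  moreover have "c ^ 3 - m ^ 3 = (c - m) * (c * c + c * m + m * m)"
    by (simp add: power3_eq_cube algebra_simps)
  ultimately show "\<bar>c ^ 3 - m ^ 3\<bar> < 12 * e"
    using assms(1) by (simp add: abs_mult)
qed

lemma near_less:
  fixes x a r lo hi :: real
  assumes "\<bar>x - a\<bar> < r"
  shows "lo \<le> a - r \<Longrightarrow> lo < x" "a + r \<le> hi \<Longrightarrow> x < hi"
  using assms by linarith+

lemma trace_1_powers:
  "1.956295199 < trace 1" "trace 1 < 1.956295204"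
  "3.827090913 < (trace 1)\<^sup>2" "(trace 1)\<^sup>2 < 3.827090918"
  "7.486919591 < (trace 1) ^ 3" "(trace 1) ^ 3 < 7.486919596"
  by (rule near_less[OF trace_bounds(1)]
      near_less[OF power_bounds(1)[OF trace_bounds(1)]] near_less[OF power_bounds(2)[OF trace_bounds(1)]];
      simp add: power_divide)+

lemma trace_11_powers:
  "- 1.338261215 < trace 11" "trace 11 < - 1.338261210"
  "1.790943071 < (trace 11)\<^sup>2" "(trace 11)\<^sup>2 < 1.790943076"
  "- 2.396749652 < (trace 11) ^ 3" "(trace 11) ^ 3 < - 2.396749647"
  by (rule near_less[OF trace_bounds(3)]
      near_less[OF power_bounds(1)[OF trace_bounds(3)]] near_less[OF power_bounds(2)[OF trace_bounds(3)]];
      simp add: power_divide)+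

lemma trace_7_powers:
  "0.209056924 < trace 7" "trace 7 < 0.209056929"
  "0.043704796 < (trace 7)\<^sup>2" "(trace 7)\<^sup>2 < 0.043704801"
  "0.009136788 < (trace 7) ^ 3" "(trace 7) ^ 3 < 0.009136793"
  by (rule near_less[OF trace_bounds(4)]
      near_less[OF power_bounds(1)[OF trace_bounds(4)]] near_less[OF power_bounds(2)[OF trace_bounds(4)]];
      simp add: power_divide)+

lemma trace_13_powers:
  "- 1.827090918 < trace 13" "trace 13 < - 1.827090913"
  "3.338261210 < (trace 13)\<^sup>2" "(trace 13)\<^sup>2 < 3.338261215"
  "- 6.099306737 < (trace 13) ^ 3" "(trace 13) ^ 3 < - 6.099306732"
  by (rule near_less[OF trace_bounds(2)]
      near_less[OF power_bounds(1)[OF trace_bounds(2)]] near_less[OF power_bounds(2)[OF trace_bounds(2)]];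
      simp add: power_divide)+

text \<open>
  The vectors of the theorem for suitable scalings. The second one is fixed by the last four
  reflections; its scaling is close to \<open>\<surd>2\<close> in all four planes, but in the Coxeter plane \<open>\<surd>2\<close> itself
  would give \<open>3.9416\<close> instead of \<open>3.9417\<close>.
\<close>

definition first_vector :: "real \<Rightarrow> nat \<Rightarrow> cl8" where
  "first_vector r k = r *\<^sub>R plane_vec (trace k)"

definition second_vector :: "real \<Rightarrow> nat \<Rightarrow> cl8" where
  "second_vector p k = p *\<^sub>R (plane_vec (trace k) + coxeter_element (plane_vec (trace k)))"

lemma vector_pair_vec8:
  "first_vector r k = (let c = trace k in
     vec8 0 0 r r (r * (c ^ 3 - 3 * c)) (r * (c ^ 3 - 3 * c)) (r * (c\<^sup>2 - 2)) (r * (c\<^sup>2 + 2 * c)))"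
  "second_vector p k = (let c = trace k; h = c ^ 3 / 2 in
     vec8 (p * (h - 2 * c)) (p * (1 + 2 * c - h)) (p * (1 + 2 * c - h)) (p * (1 - c + h)) (p * (1 - c + h))
       (p * (c\<^sup>2 - 2 - c + h)) (p * (c\<^sup>2 - 2 - c + h)) (p * (2 * c\<^sup>2 + 2 * c + h)))"
  unfolding first_vector_def second_vector_def Let_def coxeter_plane_vec
  by (simp add: plane_vec_def vec8_linear)
     (simp only: plane_vec_def vec8_linear; rule vec8_cong; simp add: algebra_simps)

lemma rounding_1:
  "vector_rounds_to (first_vector 2.81293 1)
         [(3, 2.8129, 4), (4, 2.8129, 4), (5, 4.5514, 4), (6, 4.5514, 4),
          (7, 5.1395, 4), (8, 21.771, 3)]"
  "vector_rounds_to (second_vector 1.414216 1)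
         [(1, - 0.23919, 5), (2, 1.6534, 4), (3, 1.6534, 4), (4, 3.9417, 4),
          (5, 3.9417, 4), (6, 5.1113, 4), (7, 5.1113, 4), (8, 21.652, 3)]"
  unfolding vector_pair_vec8 Let_def
  by (rule vector_rounds_to_vec8; simp?; (rule rounds_to_near)?; insert trace_1_powers; simp?; linarith?)+

lemma rounding_11:
  "vector_rounds_to (first_vector 1.1504 11)
         [(3, 1.1504, 4), (4, 1.1504, 4), (5, 1.8614, 4), (6, 1.8614, 4),
          (7, - 0.2405, 4), (8, - 1.0188, 4)]"
  "vector_rounds_to (second_vector 1.414215 11)
         [(1, 2.0904, 4), (2, - 0.6762, 4), (3, - 0.6762, 4), (4, 1.612, 3),
          (5, 1.612, 3), (6, - 0.097822, 6), (7, - 0.097822, 6), (8, - 0.4144, 4)]"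
  unfolding vector_pair_vec8 Let_def
  by (rule vector_rounds_to_vec8; simp?; (rule rounds_to_near)?; insert trace_11_powers; simp?; linarith?)+

lemma rounding_7:
  "vector_rounds_to (first_vector 2.10193 7)
         [(3, 2.1019, 4), (4, 2.1019, 4), (5, - 1.2991, 4), (6, - 1.2991, 4),
          (7, - 4.112, 3), (8, 0.97071, 5)]"
  "vector_rounds_to (second_vector 1.414216 7)
         [(1, - 0.58484, 5), (2, 1.9991, 4), (3, 1.9991, 4), (4, 1.125, 3),
          (5, 1.125, 3), (6, - 3.0558, 4), (7, - 3.0558, 4), (8, 0.72138, 5)]"
  unfolding vector_pair_vec8 Let_def
  by (rule vector_rounds_to_vec8; simp?; (rule rounds_to_near)?; insert trace_7_powers; simp?; linarith?)+

lemma rounding_13: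
  "vector_rounds_to (first_vector 0.58806 13)
         [(3, 0.58806, 5), (4, 0.58806, 5), (5, - 0.36344, 5), (6, - 0.36344, 5),
          (7, 0.78698, 5), (8, - 0.18578, 5)]"
  "vector_rounds_to (second_vector 1.41421 13)
         [(1, 0.85493, 5), (2, 0.55928, 5), (3, 0.55928, 5), (4, - 0.31475, 5),
          (5, - 0.31475, 5), (6, 0.16362, 5), (7, 0.16362, 5), (8, - 0.038626, 6)]"
  unfolding vector_pair_vec8 Let_def
  by (rule vector_rounds_to_vec8; simp?; (rule rounds_to_near)?; insert trace_13_powers; simp?; linarith?)+

lemma vector_pair_plane:
  assumes "k \<in> {1, 7, 11, 13}" "0 < r" "0 < p"
  shows "unit_bivector (first_vector r k) (second_vector p k) = axis1 k * axis2 k"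
    and "span {first_vector r k, second_vector p k} = span {axis1 k, axis2 k}"
  unfolding first_vector_def second_vector_def by (rule axis_pair[OF assms])+

theorem mainTheorem4:
  shows
    "coxeter_versor = (1/16) *\<^sub>R
       (- 1 + eprod [2,3,4,5,6,7] + eprod [1,2,3,4,5,6,7,8] - eprod [1,4,5,6,7,8]
        - eprod [1,2,3,6,7,8] - eprod [4,5,6,7] - eprod [2,3,6,7] + eprod [1,6,7,8]
        + eprod [1,2,5,6,7,8] + eprod [6,7] + eprod [2,5,6,7] + eprod [1,3,5,6,7,8]
        - eprod [1,2,4,6,7,8] + eprod [3,5,6,7] - eprod [2,4,6,7] - eprod [1,3,4,6,7,8]
        - eprod [3,4,6,7] + eprod [1,3,4,8] + eprod [3,4] + eprod [1,2,3,4,7,8] - eprod [1,4,7,8]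
        + eprod [2,3,4,7] + eprod [1,2,3,5,7,8] - eprod [4,7] + eprod [2,3,5,7] - eprod [1,5,7,8]
        - eprod [5,7] - 2 * eprod [1,5,6,7] + eprod [1,5,6,8] + eprod [1,2,7,8] + eprod [5,6]
        + eprod [1,3,7,8] + eprod [3,7] + eprod [2,4,5,7] + eprod [1,3,4,5,7,8] + 2 * eprod [1,3,4,7]
        - eprod [1,3,4,5,6,8] + eprod [3,4,5,7] + 6 * eprod [1,3,4,5,6,7] - eprod [3,4,5,6]
        + 4 * eprod [1,2,4,5,6,7] - eprod [1,2,4,5,6,8] - eprod [1,2,6,8] - eprod [2,4,5,6]
        + 2 * eprod [1,2,6,7] - eprod [1,2,3,5,6,8] + eprod [2,7] + 2 * eprod [1,7] - eprod [1,8]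
        - eprod [2,6] + 4 * eprod [1,2,3,5,6,7] - eprod [2,3,5,6] + 2 * eprod [1,2,3,4,6,7]
        - eprod [1,2,3,4,6,8] - eprod [2,3,4,6] + eprod [1,2,4,8] + eprod [2,4] - eprod [1,2,5,8]
        + 2 * eprod [1,2,5,7] - eprod [2,5] + eprod [1,2,3,8] + eprod [2,3] - eprod [1,2,3,4,5,8]
        + 2 * eprod [1,2,3,4,5,7] + eprod [1,4,6,8] - eprod [2,3,4,5] + eprod [1,2,4,5,7,8]
        - 4 * eprod [1,4,6,7] - eprod [1,3,6,8] + eprod [1,4,5,8] + 4 * eprod [1,3,5,7]
        - eprod [1,3,5,8] - 2 * eprod [1,4,5,6] - 2 * eprod [1,3,5,6] - 4 * eprod [1,3,4,6]
        + 2 * eprod [1,4] + 2 * eprod [1,3] - 4 * eprod [1,3,4,5] - 2 * eprod [1,2,4,6]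
        - 2 * eprod [1,2,3,6] - 2 * eprod [1,2,4,5] - 2 * eprod [1,2,3,5] + eprod [4,6] + eprod [4,5]
        - eprod [3,6] - eprod [3,5]) \<and>
     (\<forall>v\<in>vectors. coxeter_element v = reversal coxeter_versor * v * coxeter_versor) \<and>
     (\<exists>v1 w1 v2 w2 v3 w3 v4 w4.
       vector_rounds_to v1
         [(3, 2.8129, 4), (4, 2.8129, 4), (5, 4.5514, 4), (6, 4.5514, 4),
          (7, 5.1395, 4), (8, 21.771, 3)] \<and>
       vector_rounds_to w1
         [(1, - 0.23919, 5), (2, 1.6534, 4), (3, 1.6534, 4), (4, 3.9417, 4),
          (5, 3.9417, 4), (6, 5.1113, 4), (7, 5.1113, 4), (8, 21.652, 3)] \<and>
       vector_rounds_to v2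
         [(3, 1.1504, 4), (4, 1.1504, 4), (5, 1.8614, 4), (6, 1.8614, 4),
          (7, - 0.2405, 4), (8, - 1.0188, 4)] \<and>
       vector_rounds_to w2
         [(1, 2.0904, 4), (2, - 0.6762, 4), (3, - 0.6762, 4), (4, 1.612, 3),
          (5, 1.612, 3), (6, - 0.097822, 6), (7, - 0.097822, 6), (8, - 0.4144, 4)] \<and>
       vector_rounds_to v3
         [(3, 2.1019, 4), (4, 2.1019, 4), (5, - 1.2991, 4), (6, - 1.2991, 4),
          (7, - 4.112, 3), (8, 0.97071, 5)] \<and>
       vector_rounds_to w3
         [(1, - 0.58484, 5), (2, 1.9991, 4), (3, 1.9991, 4), (4, 1.125, 3),
          (5, 1.125, 3), (6, - 3.0558, 4), (7, - 3.0558, 4), (8, 0.72138, 5)] \<and>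
       vector_rounds_to v4
         [(3, 0.58806, 5), (4, 0.58806, 5), (5, - 0.36344, 5), (6, - 0.36344, 5),
          (7, 0.78698, 5), (8, - 0.18578, 5)] \<and>
       vector_rounds_to w4
         [(1, 0.85493, 5), (2, 0.55928, 5), (3, 0.55928, 5), (4, - 0.31475, 5),
          (5, - 0.31475, 5), (6, 0.16362, 5), (7, 0.16362, 5), (8, - 0.038626, 6)] \<and>
       coxeter_versor =
         - (exp ((pi / 30) *\<^sub>R unit_bivector v1 w1) *
            exp ((11 * pi / 30) *\<^sub>R unit_bivector v2 w2) *
            exp ((7 * pi / 30) *\<^sub>R unit_bivector v3 w3) *
            exp ((13 * pi / 30) *\<^sub>R unit_bivector v4 w4)) \<and>
       orthogonal_planes (span {v1, w1}) (span {v2, w2}) \<and>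
       orthogonal_planes (span {v1, w1}) (span {v3, w3}) \<and>
       orthogonal_planes (span {v1, w1}) (span {v4, w4}) \<and>
       orthogonal_planes (span {v2, w2}) (span {v3, w3}) \<and>
       orthogonal_planes (span {v2, w2}) (span {v4, w4}) \<and>
       orthogonal_planes (span {v3, w3}) (span {v4, w4}) \<and>
       is_coxeter_plane (span {v1, w1}) \<and>
       rotates_plane coxeter_element (span {v1, w1}) (2 * pi * 1 / 30) \<and>
       rotates_plane coxeter_element (span {v2, w2}) (2 * pi * 11 / 30) \<and>
       rotates_plane coxeter_element (span {v3, w3}) (2 * pi * 7 / 30) \<and>
       rotates_plane coxeter_element (span {v4, w4}) (2 * pi * 13 / 30)) \<and>
     exponents = {1, 7, 11, 13, 17, 19, 23, 29} \<and>
     {z. eigenvalue coxeter_matrix z} =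
       (\<lambda>m::nat. exp (2 * of_real pi * \<i> * of_nat m / 30)) ` {1, 7, 11, 13, 17, 19, 23, 29}"
proof -
  \<comment> \<open>All prescribed digits of a vector are met for scalings in a short interval only; the decimals are points of these intervals.\<close>
  have planes: "span {first_vector 2.81293 1, second_vector 1.414216 1} = span {axis1 1, axis2 1}"
    "span {first_vector 1.1504 11, second_vector 1.414215 11} = span {axis1 11, axis2 11}"
    "span {first_vector 2.10193 7, second_vector 1.414216 7} = span {axis1 7, axis2 7}"
    "span {first_vector 0.58806 13, second_vector 1.41421 13} = span {axis1 13, axis2 13}"
    by (simp_all add: vector_pair_plane(2))
  have "rotor 1 = exp ((pi / 30) *\<^sub>R unit_bivector (first_vector 2.81293 1) (second_vector 1.414216 1))"
    "rotor 11 = exp ((11 * pi / 30) *\<^sub>R unit_bivector (first_vector 1.1504 11) (second_vector 1.414215 11))"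
    "rotor 7 = exp ((7 * pi / 30) *\<^sub>R unit_bivector (first_vector 2.10193 7) (second_vector 1.414216 7))"
    "rotor 13 = exp ((13 * pi / 30) *\<^sub>R unit_bivector (first_vector 0.58806 13) (second_vector 1.41421 13))"
    unfolding rotor_def by (simp_all add: vector_pair_plane(1) turn_def mult.commute)
  note rotors = this[symmetric]
  have factorisation: "coxeter_versor = - (rotor 1 * rotor 11 * rotor 7 * rotor 13)"
    using versor_factorisation[of "[1, 11, 7, 13]"] by (simp add: mult.assoc insert_commute)
  have turns: "2 * pi / 30 = turn 1" "2 * pi * 1 / 30 = turn 1" "2 * pi * 11 / 30 = turn 11"
    "2 * pi * 7 / 30 = turn 7" "2 * pi * 13 / 30 = turn 13"
    by (simp_all add: turn_def)
  let "_ \<and> _ \<and> ?planes \<and> _" = ?thesis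
  have ?planes
    by (intro exI conjI, (rule rounding_1 rounding_11 rounding_7 rounding_13)+,
        unfold planes rotors turns is_coxeter_plane_def, rule factorisation)
       (intro conjI allI impI orthogonal_axis_planes rotates_axis_plane rotates_plane_unique; simp)+
  then show ?thesis
    unfolding exp_turn
    by (intro conjI ballI coxeter_versor_expansion coxeter_element_versor exponents_eq
        eigenvalues_coxeter_matrix)
qed

end
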